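(* Let $f$ be a meromorphic function in the unit disc $\mathbb{D}$, and let $\psi_1$, $\psi_2$, $\psi_3$ be three meromorphic functions in $\mathbb{D}$, continuous on $\partial\mathbb{D}$, such that $\psi_i(z)\neq\psi_j(z)$ for all $z\in\partial\mathbb{D}$ and all $1\leq i<j\leq 3$. If $\psi_1$, $\psi_2$ and $\psi_3$ share the function $f$ on $\mathbb{D}$, that is, $$\{z\in\mathbb{D}:\psi_1(z)=f(z)\}=\{z\in\mathbb{D}:\psi_2(z)=f(z)\}=\{z\in\mathbb{D}:\psi_3(z)=f(z)\},$$ then $f$ is a normal function.
   Context: $\mathbb{D}=\{z\in\mathbb{C}:|z|<1\}$ and $\partial\mathbb{D}=\{z\in\mathbb{C}:|z|=1\}$. Meromorphic functions are regarded as maps into the Riemann sphere $\hat{\mathbb{C}}=\mathbb{C}\cup\{\infty\}$ with the spherical metric; in particular the value $\infty$ is allowed, and equality of two functions at a point means equality in $\hat{\mathbb{C}}$ (so common poles count as points of equality). A meromorphic function $\psi$ in $\mathbb{D}$ is "continuous on $\partial\mathbb{D}$" if it is defined on $\overline{\mathbb{D}}=\mathbb{D}\cup\partial\mathbb{D}$ and is continuous at every point of $\partial\mathbb{D}$ as a map $\overline{\mathbb{D}}\to\hat{\mathbb{C}}$ (so $\psi:\overline{\mathbb{D}}\to\hat{\mathbb{C}}$ is continuous and meromorphic in $\mathbb{D}$). Sharing ignores multiplicities: it means only the equality of the sets of points displayed in the claim. A meromorphic function $f$ in $\mathbb{D}$ is called normal if the family $\{f\circ\varphi:\varphi\in\mathrm{Aut}(\mathbb{D})\}$,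 where $\mathrm{Aut}(\mathbb{D})$ is the group of conformal automorphisms of $\mathbb{D}$, is a normal family in $\mathbb{D}$ with respect to the spherical metric, i.e. every sequence in the family has a subsequence converging uniformly on compact subsets of $\mathbb{D}$ in the spherical metric (to a meromorphic function or to the constant $\infty$). *)

theory Defs
  imports "HOL-Complex_Analysis.Complex_Analysis"
begin

datatype riemann_sphere = Fin complex | Infty

text \<open>
  Inverse stereographic projection from the north pole $(0, 1)$ onto the unit sphere of
  $\mathbb{C} \times \mathbb{R} \cong \mathbb{R}^3$.
\<close>
fun stereo :: "riemann_sphere \<Rightarrow> complex \<times> real" where
  "stereo (Fin z) = ((2 / (1 + (cmod z)\<^sup>2)) *\<^sub>R z, ((cmod z)\<^sup>2 - 1) / ((cmod z)\<^sup>2 + 1))"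
| "stereo Infty = (0, 1)"

lemma norm_stereo: "norm (stereo p) = 1"
proof (cases p)
  case (Fin z)
  define s where "s = (cmod z)\<^sup>2"
  have pos: "1 + s > 0"
    unfolding s_def by (simp add: add_pos_nonneg)
  have "(norm (stereo p))\<^sup>2 = (norm ((2 / (1 + s)) *\<^sub>R z))\<^sup>2 + (norm ((s - 1) / (s + 1)))\<^sup>2"
    by (simp only: Fin stereo.simps norm_Pair s_def) simp
  also have "\<dots> = (2 / (1 + s))\<^sup>2 * s + ((s - 1) / (s + 1))\<^sup>2"
    by (simp add: power_mult_distrib power_divide flip: s_def)
  also have "\<dots> = (4 * s + (s - 1)\<^sup>2) / (1 + s)\<^sup>2"
    by (simp only: power_divide add.commute[of s 1] add_divide_distrib) simp
  also have "4 * s + (s - 1)\<^sup>2 = (1 + s)\<^sup>2"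
    by (simp add: power2_eq_square algebra_simps)
  finally have "(norm (stereo p))\<^sup>2 = 1\<^sup>2"
    using pos by simp
  then show ?thesis
    by (rule power2_eq_imp_eq) simp_all
qed (simp add: norm_Pair)

lemma inj_stereo: "stereo p = stereo q \<longleftrightarrow> p = q"
proof -
  have less: "((cmod z)\<^sup>2 - 1) / ((cmod z)\<^sup>2 + 1) < 1" for z
    by (subst divide_less_eq_1_pos) (simp_all add: add_nonneg_pos)
  have fin: "z = w" if eq: "stereo (Fin z) = stereo (Fin w)" for z w
  proof -
    define s t where "s = (cmod z)\<^sup>2" and "t = (cmod w)\<^sup>2"
    have pos: "s + 1 > 0" "t + 1 > 0"
      unfolding s_def t_def by (simp_all add: add_nonneg_pos)
    have 1: "(2 / (1 + s)) *\<^sub>R z = (2 / (1 + t)) *\<^sub>R w" and 2: "(s - 1) / (s + 1) = (t - 1) / (t + 1)"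
      using eq by (simp_all only: stereo.simps prod.inject s_def t_def)
    have "(s - 1) * (t + 1) = (t - 1) * (s + 1)"
      using 2 pos frac_eq_eq[of "s + 1" "t + 1" "s - 1" "t - 1"] by linarith
    then have "s = t"
      by (simp add: algebra_simps)
    then show "z = w"
      using 1 pos by simp
  qed
  show ?thesis
  proof (cases p; cases q)
    fix z assume "p = Fin z" "q = Infty"
    then show ?thesis using less[of z] by simp
  next
    fix z assume "p = Infty" "q = Fin z"
    then show ?thesis using less[of z] by simp
  next
    fix z w assume "p = Fin z" "q = Fin w"
    then show ?thesis using fin[of z w] by blast
  qed simp
qed

text \<open>The angle triangle inequality for unit vectors.\<close>
lemma arccos_inner_triangle:
  fixes x y z :: "'a :: real_inner"
  assumes x: "norm x = 1" and y: "norm y = 1" and z: "norm z = 1"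
  shows "arccos (x \<bullet> y) \<le> arccos (x \<bullet> z) + arccos (y \<bullet> z)"
proof (cases "arccos (x \<bullet> z) + arccos (y \<bullet> z) \<le> pi")
  case True
  define a b where "a = x \<bullet> z" and "b = y \<bullet> z"
  have ab: "\<bar>a\<bar> \<le> 1" "\<bar>b\<bar> \<le> 1" and xy: "\<bar>x \<bullet> y\<bar> \<le> 1"
    using Cauchy_Schwarz_ineq2[of x z] Cauchy_Schwarz_ineq2[of y z] Cauchy_Schwarz_ineq2[of x y] x y z
    by (simp_all add: a_def b_def)
  have xx: "x \<bullet> x = 1" "y \<bullet> y = 1" "z \<bullet> z = 1"
    using x y z by (simp_all add: norm_eq_1)
  have zx: "z \<bullet> x = a" and zy: "z \<bullet> y = b"
    by (simp_all add: a_def b_def inner_commute)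
  note inner_simps' = inner_diff_left inner_diff_right inner_scaleR_left inner_scaleR_right
    xx zx zy a_def[symmetric] b_def[symmetric]
  have "(x - a *\<^sub>R z) \<bullet> (x - a *\<^sub>R z) = 1 - a\<^sup>2" "(y - b *\<^sub>R z) \<bullet> (y - b *\<^sub>R z) = 1 - b\<^sup>2"
    by (simp_all only: inner_simps') (simp_all add: power2_eq_square)
  then have na: "norm (x - a *\<^sub>R z) = sqrt (1 - a\<^sup>2)" and nb: "norm (y - b *\<^sub>R z) = sqrt (1 - b\<^sup>2)"
    by (simp_all only: norm_eq_sqrt_inner)
  have "x \<bullet> y - a * b = (x - a *\<^sub>R z) \<bullet> (y - b *\<^sub>R z)"
    by (simp only: inner_simps') simp
  then have "a * b - sqrt (1 - a\<^sup>2) * sqrt (1 - b\<^sup>2) \<le> x \<bullet> y"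
    using Cauchy_Schwarz_ineq2[of "x - a *\<^sub>R z" "y - b *\<^sub>R z"] na nb by auto
  moreover have "cos (arccos a + arccos b) = a * b - sqrt (1 - a\<^sup>2) * sqrt (1 - b\<^sup>2)"
    using ab by (simp add: cos_add sin_arccos_abs cos_arccos_abs)
  ultimately have "arccos (x \<bullet> y) \<le> arccos (cos (arccos a + arccos b))"
    using xy cos_ge_minus_one[of "arccos a + arccos b"] by (intro arccos_le_arccos) linarith+
  also have "\<dots> = arccos a + arccos b"
    using True ab arccos_lbound[of a] arccos_lbound[of b]
    by (intro arccos_cos) (simp_all add: abs_le_iff flip: a_def b_def)
  finally show ?thesis
    by (simp add: a_def b_def)
next
  case False
  have "\<bar>x \<bullet> y\<bar> \<le> 1"
    using Cauchy_Schwarz_ineq2[of x y] x y by simp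
  then have "arccos (x \<bullet> y) \<le> pi"
    by (intro arccos_ubound) auto
  then show ?thesis
    using False by linarith
qed

text \<open>
  The distance is the spherical (great-circle) one: the angle between the corresponding unit
  vectors.
\<close>
instantiation riemann_sphere :: metric_space
begin

definition dist_riemann_sphere :: "riemann_sphere \<Rightarrow> riemann_sphere \<Rightarrow> real" where
  "dist_riemann_sphere p q = arccos (stereo p \<bullet> stereo q)"

definition uniformity_riemann_sphere :: "(riemann_sphere \<times> riemann_sphere) filter" where
  "uniformity_riemann_sphere = (INF e\<in>{0<..}. principal {(p, q). dist p q < e})"

definition open_riemann_sphere :: "riemann_sphere set \<Rightarrow> bool" where
  "open_riemann_sphere U \<longleftrightarrow> (\<forall>p\<in>U. eventually (\<lambda>(p', q). p' = p \<longrightarrow> q \<in> U) uniformity)"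

instance
proof
  fix p q r :: riemann_sphere
  have bound: "\<bar>stereo p \<bullet> stereo q\<bar> \<le> 1"
    using Cauchy_Schwarz_ineq2[of "stereo p" "stereo q"] by (simp add: norm_stereo)
  have self: "stereo p \<bullet> stereo p = 1" "stereo q \<bullet> stereo q = 1"
    using norm_stereo by (simp_all add: norm_eq_1)
  have "dist p q = 0 \<longleftrightarrow> stereo p \<bullet> stereo q = 1"
    unfolding dist_riemann_sphere_def using bound cos_arccos_abs[of "stereo p \<bullet> stereo q"]
    by (metis arccos_1 cos_zero)
  also have "\<dots> \<longleftrightarrow> (stereo p - stereo q) \<bullet> (stereo p - stereo q) = 0"
    by (simp add: inner_diff_left inner_diff_right self inner_commute[of "stereo q" "stereo p"])
  also have "\<dots> \<longleftrightarrow> p = q"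
    by (simp add: inj_stereo)
  finally show "dist p q = 0 \<longleftrightarrow> p = q" .
  show "dist p q \<le> dist p r + dist q r"
    unfolding dist_riemann_sphere_def by (intro arccos_inner_triangle norm_stereo)
qed (simp_all add: uniformity_riemann_sphere_def open_riemann_sphere_def)

end

text \<open>
  The value at a pole is \<^const>\<open>Infty\<close>. Outside its poles a function in the sense of
  \<^const>\<open>nicely_meromorphic_on\<close> is holomorphic, so removable singularities carry no
  arbitrary values. The constant function \<^const>\<open>Infty\<close> is not meromorphic.
\<close>
definition meromorphic_map_on :: "(complex \<Rightarrow> riemann_sphere) \<Rightarrow> complex set \<Rightarrow> bool" where
  "meromorphic_map_on f S \<longleftrightarrow>
     (\<exists>g. g nicely_meromorphic_on S \<and> (\<forall>z\<in>S. f z = (if is_pole g z then Infty else Fin (g z))))"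

definition disc_automorphisms :: "(complex \<Rightarrow> complex) set" where
  "disc_automorphisms = {\<phi>. \<phi> holomorphic_on ball 0 1 \<and> bij_betw \<phi> (ball 0 1) (ball 0 1)}"

definition normal_family_on :: "complex set \<Rightarrow> (complex \<Rightarrow> riemann_sphere) set \<Rightarrow> bool" where
  "normal_family_on S F \<longleftrightarrow>
     (\<forall>u :: nat \<Rightarrow> complex \<Rightarrow> riemann_sphere. range u \<subseteq> F \<longrightarrow>
       (\<exists>r g. strict_mono r
            \<and> (meromorphic_map_on g S \<or> (\<forall>z\<in>S. g z = Infty))
            \<and> (\<forall>K. compact K \<and> K \<subseteq> S \<longrightarrow> uniform_limit K (u \<circ> r) g sequentially)))"

definition normal_function :: "(complex \<Rightarrow> riemann_sphere) \<Rightarrow> bool" where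
  "normal_function f \<longleftrightarrow>
     meromorphic_map_on f (ball 0 1)
     \<and> normal_family_on (ball 0 1) {f \<circ> \<phi> | \<phi>. \<phi> \<in> disc_automorphisms}"

end

theory Submission
  imports Defs
begin

text \<open>
  Every sequence of holomorphic self-maps of the disc has a subsequence $\varphi_n$ converging locally
  uniformly to some $\Phi$, so it suffices to show that a subsequence of $f \circ \varphi_n$
  converges. If $\Phi$ maps the disc into itself, $f \circ \varphi_n \to f \circ \Phi$. Otherwise
  $\Phi$ is a constant $\zeta$ on the unit circle. Near $\zeta$ the functions $\psi_i$ are pairwise
  distinct, hence a common solution of $\psi_i = f$ is impossible and $f$ omits all three $\psi_i$
  there. The cross ratio of $f, \psi_1, \psi_2, \psi_3$ then omits $0$, $1$, $\infty$, so along
  $\varphi_n$ it has a locally uniformly convergent subsequence by Schottky's theorem. Since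
  $\psi_i \circ \varphi_n \to \psi_i(\zeta)$, three distinct points, inverting the cross ratio
  gives convergence of $f \circ \varphi_n$. No value is treated separately because points of the
  sphere are written in homogeneous coordinates.
\<close>

subsection \<open>Locally uniform limits\<close>

lemma uniform_limit_Pair:
  assumes "uniform_limit K f a F" and "uniform_limit K g b F"
  shows "uniform_limit K (\<lambda>n z. (f n z, g n z)) (\<lambda>z. (a z, b z)) F"
proof (rule uniform_limitI)
  fix e :: real assume "e > 0"
  then have "\<forall>\<^sub>F n in F. \<forall>z\<in>K. dist (f n z) (a z) < e / 2"
    and "\<forall>\<^sub>F n in F. \<forall>z\<in>K. dist (g n z) (b z) < e / 2"
    using uniform_limitD[OF assms(1), of "e / 2"] uniform_limitD[OF assms(2), of "e / 2"]
    by simp_all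
  then show "\<forall>\<^sub>F n in F. \<forall>z\<in>K. dist (f n z, g n z) (a z, b z) < e"
  proof eventually_elim
    case (elim n)
    show ?case
    proof
      fix z assume "z \<in> K"
      have "dist (f n z, g n z) (a z, b z) \<le> dist (f n z) (a z) + dist (g n z) (b z)"
        by (simp add: dist_Pair_Pair sqrt_sum_squares_le_sum)
      also have "\<dots> < e"
        using elim \<open>z \<in> K\<close> by (metis add_strict_mono field_sum_of_halves)
      finally show "dist (f n z, g n z) (a z, b z) < e" .
    qed
  qed
qed

lemma uniform_limit_compose_continuous_on_open:
  fixes f :: "'a :: heine_borel \<Rightarrow> 'b :: metric_space"
  assumes f: "continuous_on S f" and "open S"
    and lim: "uniform_limit K g l F" and l: "compact (l ` K)" "l ` K \<subseteq> S"
  shows "uniform_limit K (\<lambda>n z. f (g n z)) (\<lambda>z. f (l z)) F"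
proof (cases "K = {}")
  case False
  then obtain e where e: "e > 0" "{x. infdist x (l ` K) \<le> e} \<subseteq> S"
    using compact_in_open_separated[OF _ l(1) \<open>open S\<close> l(2)] by blast
  let ?U = "{x. infdist x (l ` K) \<le> e}"
  have "compact ?U"
    using False e l by (intro compact_infdist_le) auto
  then have "uniformly_continuous_on ?U f"
    using e f by (intro compact_uniformly_continuous) (auto intro: continuous_on_subset)
  moreover have "\<forall>\<^sub>F n in F. \<forall>z\<in>K. dist (g n z) (l z) < e"
    using lim e(1) by (rule uniform_limitD)
  then have "\<forall>\<^sub>F n in F. \<forall>z\<in>K. g n z \<in> ?U"
  proof eventually_elim
    case (elim n)
    show ?case
    proof
      fix z assume "z \<in> K"
      then have "infdist (g n z) (l ` K) \<le> dist (g n z) (l z)"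
        by (intro infdist_le) auto
      then show "g n z \<in> ?U"
        using elim \<open>z \<in> K\<close> by force
    qed
  qed
  ultimately show ?thesis
    by (rule uniform_limit_compose_uniformly_continuous_on[OF lim _ _ compact_imp_closed[OF \<open>compact ?U\<close>]])
qed (simp add: uniform_limit_iff)

text \<open>Since the inner limit is the constant \<open>c\<close>, a single radius from the limit
  of \<open>h\<close> at \<open>c\<close> serves all points of \<open>K\<close>. That limit is
  punctured, hence the requirement that \<open>g n\<close> avoids \<open>c\<close>.\<close>

lemma uniform_limit_compose_at_within:
  assumes h: "(h \<longlongrightarrow> l) (at c within S)"
    and g: "uniform_limit K g (\<lambda>_. c) F" and gS: "\<And>n z. z \<in> K \<Longrightarrow> g n z \<in> S - {c}"
  shows "uniform_limit K (\<lambda>n z. h (g n z)) (\<lambda>_. l) F"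
proof (rule uniform_limitI)
  fix e :: real assume "e > 0"
  then obtain d where "d > 0" and d: "\<And>x. x \<in> S \<Longrightarrow> x \<noteq> c \<Longrightarrow> dist x c < d \<Longrightarrow> dist (h x) l < e"
    using tendstoD[OF h \<open>e > 0\<close>] by (auto simp: eventually_at)
  have "\<forall>\<^sub>F n in F. \<forall>z\<in>K. dist (g n z) c < d"
    using g \<open>d > 0\<close> by (rule uniform_limitD)
  then show "\<forall>\<^sub>F n in F. \<forall>z\<in>K. dist (h (g n z)) l < e"
    by eventually_elim (use d gS in blast)
qed

text \<open>Removes a shrinking factor that tends to 1: \<open>u n z\<close> is the rescaled
  function at \<open>z / \<rho> n\<close>, a point close to \<open>z\<close>, and \<open>g\<close>
  is uniformly continuous on a disc slightly larger than \<open>K\<close>.\<close>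

lemma uniform_limit_rescale:
  fixes u :: "nat \<Rightarrow> complex \<Rightarrow> 'b :: metric_space"
  assumes \<rho>: "\<rho> \<longlonglongrightarrow> 1" "\<And>n. 0 < \<rho> n"
    and g: "continuous_on (ball 0 1) g"
    and lim: "\<And>K. compact K \<Longrightarrow> K \<subseteq> ball 0 1 \<Longrightarrow>
      uniform_limit K (\<lambda>n z. u n (of_real (\<rho> n) * z)) g sequentially"
    and K: "compact K" "K \<subseteq> ball 0 1"
  shows "uniform_limit K u g sequentially"
proof -
  obtain s where s: "0 < s" "s < 1" "K \<subseteq> cball 0 s"
  proof (cases "K = {}")
    case False
    then obtain x where x: "x \<in> K" "\<forall>y\<in>K. norm y \<le> norm x"
      using continuous_attains_sup[OF K(1), of norm] by (auto intro: continuous_intros)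
    then have "norm x < 1" using K by auto
    show ?thesis
    proof (rule that[of "(norm x + 1) / 2"])
      show "0 < (norm x + 1) / 2" by (simp add: add_nonneg_pos)
      show "(norm x + 1) / 2 < 1" using \<open>norm x < 1\<close> by simp
      have "norm x \<le> (norm x + 1) / 2" using \<open>norm x < 1\<close> by simp
      then show "K \<subseteq> cball 0 ((norm x + 1) / 2)" using x(2) by force
    qed
  qed (rule that[of "1/2"], auto)
  \<comment> \<open>A radius strictly between \<open>s\<close> and 1 leaves room for dividing by
    \<open>\<rho> n\<close>: points of norm at most \<open>s\<close> stay in
    \<open>cball 0 t\<close> once \<open>s / \<rho> n < t\<close>.\<close>
  define t where "t = (1 + s) / 2"
  have t: "s < t" "t < 1" using s by (auto simp: t_def)
  have sub: "cball 0 t \<subseteq> ball (0::complex) 1" using t by auto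
  have ug: "uniformly_continuous_on (cball 0 t) g"
    using continuous_on_subset[OF g sub] by (intro compact_uniformly_continuous) auto
  show ?thesis
  proof (rule uniform_limitI)
    fix e :: real assume e: "e > 0"
    then obtain d where d: "d > 0"
      "\<And>x y. x \<in> cball 0 t \<Longrightarrow> y \<in> cball 0 t \<Longrightarrow> dist x y < d \<Longrightarrow> dist (g x) (g y) < e / 2"
      using ug unfolding uniformly_continuous_on_def by (metis half_gt_zero)
    have inv: "(\<lambda>n. 1 / \<rho> n) \<longlonglongrightarrow> 1 / 1"
      using \<rho> by (intro tendsto_intros) auto
    then have "(\<lambda>n. s * (1 / \<rho> n)) \<longlonglongrightarrow> s * (1 / 1)"
      by (rule tendsto_mult_left)
    then have "\<forall>\<^sub>F n in sequentially. s * (1 / \<rho> n) < t"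
      using t by (intro order_tendstoD) auto
    moreover have "\<forall>\<^sub>F n in sequentially. dist (1 / \<rho> n) 1 < d"
      using tendstoD[OF inv \<open>d > 0\<close>] by simp
    moreover have "\<forall>\<^sub>F n in sequentially.
        \<forall>z\<in>cball 0 t. dist (u n (of_real (\<rho> n) * z)) (g z) < e / 2"
      using e sub by (intro uniform_limitD[OF lim]) auto
    ultimately show "\<forall>\<^sub>F n in sequentially. \<forall>z\<in>K. dist (u n z) (g z) < e"
    proof eventually_elim
      case (elim n)
      show ?case
      proof
        fix z assume "z \<in> K"
        then have z: "norm z \<le> s" using s by auto
        define w where "w = z / of_real (\<rho> n)"
        have zw: "z = of_real (\<rho> n) * w"
          using \<rho>(2)[of n] by (simp add: w_def)
        have "norm w = norm z * (1 / \<rho> n)"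
          using \<rho>(2)[of n] by (simp add: w_def norm_divide)
        also have "\<dots> \<le> s * (1 / \<rho> n)"
          using z \<rho>(2)[of n] by (intro mult_right_mono) auto
        finally have w: "w \<in> cball 0 t" using elim by simp
        have "w - z = of_real (1 / \<rho> n - 1) * z"
          by (simp add: w_def algebra_simps)
        then have "dist w z = \<bar>1 / \<rho> n - 1\<bar> * norm z"
          by (simp add: dist_norm norm_mult del: of_real_diff of_real_divide)
        also have "\<dots> \<le> \<bar>1 / \<rho> n - 1\<bar> * 1"
          using z s by (intro mult_left_mono) auto
        finally have "dist w z < d" using elim by (simp add: dist_real_def)
        then have "dist (g w) (g z) < e / 2"
          using d w z t by auto
        moreover have "dist (u n z) (g w) < e / 2"
          using elim w zw by auto
        ultimately show "dist (u n z) (g z) < e"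
          using dist_triangle_half_l[of "u n z" "g w" e "g z"] by (simp add: dist_commute)
      qed
    qed
  qed
qed

section \<open>Sequences of functions omitting 0 and 1\<close>

text \<open>Schottky's theorem, in the form \<open>GPicard3\<close>, turns the bound at the single
  point \<open>w\<close> into uniform bounds on compact sets; then Montel's theorem applies.\<close>

lemma omits_0_1_normal:
  fixes G :: "nat \<Rightarrow> complex \<Rightarrow> complex"
  assumes S: "open S" "connected S"
    and hol: "\<And>n. G n holomorphic_on S" and omit: "\<And>n z. z \<in> S \<Longrightarrow> G n z \<noteq> 0 \<and> G n z \<noteq> 1"
    and w: "w \<in> S" and bound: "\<And>n. norm (G n w) \<le> 1"
  obtains H r where "H holomorphic_on S" "strict_mono (r :: nat \<Rightarrow> nat)"
    "\<And>K. compact K \<Longrightarrow> K \<subseteq> S \<Longrightarrow> uniform_limit K (\<lambda>n. G (r n)) H sequentially"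
proof -
  have bounded: "\<exists>B. \<forall>h\<in>range G. \<forall>z\<in>K. norm (h z) \<le> B" if K: "compact K" "K \<subseteq> S" for K
  proof -
    obtain B where "\<And>h z. h \<in> range G \<Longrightarrow> z \<in> K \<Longrightarrow> norm (h z) \<le> B"
      by (rule GPicard3[of S w "range G" "range G" K]) (use S w hol omit bound K in auto)
    then show ?thesis by blast
  qed
  obtain H r where "H holomorphic_on S" "strict_mono (r :: nat \<Rightarrow> nat)"
    "\<And>K. compact K \<Longrightarrow> K \<subseteq> S \<Longrightarrow> uniform_limit K (G \<circ> r) H sequentially"
    by (rule Montel[of S "range G" G]) (use S hol bounded in auto)
  then show ?thesis using that by (auto simp: o_def)
qed

text \<open>
  A limit of functions omitting the values $0$ and $1$ may be the constant $\infty$, so it is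
  described by homogeneous coordinates.
\<close>
lemma omits_0_1_normal_homogeneous:
  fixes G :: "nat \<Rightarrow> complex \<Rightarrow> complex"
  assumes S: "open S" "connected S" "S \<noteq> {}"
    and hol: "\<And>n. G n holomorphic_on S" and omit: "\<And>n z. z \<in> S \<Longrightarrow> G n z \<noteq> 0 \<and> G n z \<noteq> 1"
  obtains X Y H0 H1 r where "H0 holomorphic_on S" "H1 holomorphic_on S" "strict_mono (r :: nat \<Rightarrow> nat)"
    "\<And>z. z \<in> S \<Longrightarrow> (H0 z, H1 z) \<noteq> 0"
    "\<And>n z. z \<in> S \<Longrightarrow> Y n z \<noteq> 0 \<and> G (r n) z = X n z / Y n z"
    "\<And>K. compact K \<Longrightarrow> K \<subseteq> S \<Longrightarrow> uniform_limit K X H0 sequentially"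
    "\<And>K. compact K \<Longrightarrow> K \<subseteq> S \<Longrightarrow> uniform_limit K Y H1 sequentially"
proof -
  obtain w where w: "w \<in> S" using S by blast
  have inf: "infinite {n. norm (G n w) \<le> 1} \<or> infinite {n. norm (G n w) \<ge> 1}"
  proof (rule ccontr)
    assume "\<not> ?thesis"
    then have "finite ({n. norm (G n w) \<le> 1} \<union> {n. norm (G n w) \<ge> 1})" by simp
    also have "{n. norm (G n w) \<le> 1} \<union> {n. norm (G n w) \<ge> 1} = UNIV" by auto
    finally show False by simp
  qed
  then show ?thesis
  proof
    assume "infinite {n. norm (G n w) \<le> 1}"
    then obtain s :: "nat \<Rightarrow> nat" where s: "strict_mono s" "\<And>n. norm (G (s n) w) \<le> 1"
      using infinite_enumerate[of "{n. norm (G n w) \<le> 1}"] by auto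
    obtain H r where "H holomorphic_on S" "strict_mono (r :: nat \<Rightarrow> nat)"
      "\<And>K. compact K \<Longrightarrow> K \<subseteq> S \<Longrightarrow> uniform_limit K (\<lambda>n. G (s (r n))) H sequentially"
      by (rule omits_0_1_normal[of S "\<lambda>n. G (s n)" w]) (use S hol omit w s in auto)
    then show ?thesis
      using strict_mono_o[OF s(1)]
      by (intro that[of H "\<lambda>_. 1" "s \<circ> r" "\<lambda>_ _. 1" "\<lambda>n. G (s (r n))"])
        (simp_all add: zero_prod_def uniform_limit_const)
  next
    \<comment> \<open>The reciprocals also omit 0 and 1 and are bounded by 1 at \<open>w\<close>.
      The coordinates become 1 and the reciprocal, so the limit takes the value infinity where
      \<open>H\<close> vanishes.\<close>
    assume "infinite {n. norm (G n w) \<ge> 1}"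
    then obtain s :: "nat \<Rightarrow> nat" where s: "strict_mono s" "\<And>n. norm (G (s n) w) \<ge> 1"
      using infinite_enumerate[of "{n. norm (G n w) \<ge> 1}"] by auto
    obtain H r where "H holomorphic_on S" "strict_mono (r :: nat \<Rightarrow> nat)"
      "\<And>K. compact K \<Longrightarrow> K \<subseteq> S \<Longrightarrow> uniform_limit K (\<lambda>n z. inverse (G (s (r n)) z)) H sequentially"
      by (rule omits_0_1_normal[of S "\<lambda>n z. inverse (G (s n) z)" w])
        (use S hol omit w s in \<open>simp_all add: holomorphic_on_inverse norm_inverse inverse_le_1_iff\<close>)
    then show ?thesis
      using strict_mono_o[OF s(1)] omit
      by (intro that[of "\<lambda>_. 1" H "s \<circ> r" "\<lambda>n z. inverse (G (s (r n)) z)" "\<lambda>_ _. 1"])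
        (simp_all add: zero_prod_def uniform_limit_const inverse_eq_divide)
  qed
qed

subsection \<open>Homogeneous coordinates on the sphere\<close>

text \<open>The projection from nonzero vectors to the complex projective line, with the class of
  (a, b) read as a / b. The zero vector represents no point; its image \<open>Infty\<close> is only
  a default.\<close>

definition hproj :: "complex \<times> complex \<Rightarrow> riemann_sphere" where
  "hproj v = (if snd v = 0 then Infty else Fin (fst v / snd v))"

text \<open>This is the Hopf map, normalised to the unit sphere. One formula, continuous off the
  origin, covers finite points and infinity alike, which yields the continuity of
  \<open>hproj\<close>.\<close>

lemma stereo_hproj:
  assumes "v \<noteq> 0"
  shows "stereo (hproj v) =
    ((2 / ((cmod (fst v))\<^sup>2 + (cmod (snd v))\<^sup>2)) *\<^sub>R (fst v * cnj (snd v)),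
     ((cmod (fst v))\<^sup>2 - (cmod (snd v))\<^sup>2) / ((cmod (fst v))\<^sup>2 + (cmod (snd v))\<^sup>2))"
proof (cases "snd v = 0")
  case True
  then have "fst v \<noteq> 0" using assms by (simp add: prod_eq_iff)
  then show ?thesis using True by (simp add: hproj_def)
next
  case False
  define a b where "a = fst v" and "b = snd v"
  have b: "b \<noteq> 0" "(cmod b)\<^sup>2 > 0" using False by (auto simp: b_def)
  then have pos: "(cmod a)\<^sup>2 + (cmod b)\<^sup>2 > 0" by (simp add: add_nonneg_pos)
  have ab: "a / b = (1 / (cmod b)\<^sup>2) *\<^sub>R (a * cnj b)"
    using b by (simp add: complex_norm_square scaleR_conv_of_real field_simps flip: of_real_power)
  have "(2 / (1 + (cmod (a / b))\<^sup>2)) *\<^sub>R (a / b) =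
     (2 / (1 + (cmod a)\<^sup>2 / (cmod b)\<^sup>2) / (cmod b)\<^sup>2) *\<^sub>R (a * cnj b)"
    by (subst (2) ab) (simp add: norm_divide power_divide)
  also have "2 / (1 + (cmod a)\<^sup>2 / (cmod b)\<^sup>2) / (cmod b)\<^sup>2 = 2 / ((cmod a)\<^sup>2 + (cmod b)\<^sup>2)"
    using b by (simp only: divide_divide_eq_left) (simp add: distrib_right add.commute)
  finally have 1: "(2 / (1 + (cmod (a / b))\<^sup>2)) *\<^sub>R (a / b) =
    (2 / ((cmod a)\<^sup>2 + (cmod b)\<^sup>2)) *\<^sub>R (a * cnj b)" .
  have "((cmod (a / b))\<^sup>2 - 1) / ((cmod (a / b))\<^sup>2 + 1) =
    (((cmod a)\<^sup>2 - (cmod b)\<^sup>2) / (cmod b)\<^sup>2) / (((cmod a)\<^sup>2 + (cmod b)\<^sup>2) / (cmod b)\<^sup>2)"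
    using b by (simp add: norm_divide power_divide diff_divide_distrib add_divide_distrib)
  also have "\<dots> = ((cmod a)\<^sup>2 - (cmod b)\<^sup>2) / ((cmod a)\<^sup>2 + (cmod b)\<^sup>2)"
    using b by simp
  finally show ?thesis
    using 1 False by (simp add: hproj_def a_def b_def)
qed

section \<open>Convergence on the sphere and convergence of unit vectors\<close>

lemma inner_stereo_abs_le: "\<bar>stereo p \<bullet> stereo q\<bar> \<le> 1"
  using Cauchy_Schwarz_ineq2[of "stereo p" "stereo q"] by (simp add: norm_stereo)

text \<open>The distance is the arccosine of an inner product that tends to 1, and
  \<open>arccos\<close> is continuous on the closed interval from -1 to 1.\<close>

lemma tendsto_stereoD:
  assumes "((\<lambda>x. stereo (f x)) \<longlongrightarrow> stereo l) F"
  shows "(f \<longlongrightarrow> l) F"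
proof (rule iffD2[OF tendsto_dist_iff])
  have "((\<lambda>x. stereo (f x) \<bullet> stereo l) \<longlongrightarrow> stereo l \<bullet> stereo l) F"
    using assms by (intro tendsto_intros)
  moreover have "stereo l \<bullet> stereo l = 1"
    using norm_stereo by (simp add: norm_eq_1)
  ultimately have lim: "((\<lambda>x. stereo (f x) \<bullet> stereo l) \<longlongrightarrow> 1) F" by simp
  have "continuous_on {-1..1} arccos" by (rule continuous_on_arccos')
  then have "((\<lambda>x. arccos (stereo (f x) \<bullet> stereo l)) \<longlongrightarrow> arccos 1) F"
    by (rule continuous_on_tendsto_compose[OF _ lim])
      (use inner_stereo_abs_le in \<open>auto simp: abs_le_iff minus_le_iff intro!: always_eventually\<close>)
  then show "((\<lambda>x. dist (f x) l) \<longlongrightarrow> 0) F"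
    by (simp add: dist_riemann_sphere_def)
qed

text \<open>The chord between two unit vectors at angle t has length sqrt (2 - 2 cos t), which tends
  to 0 with t.\<close>

lemma tendsto_stereo:
  assumes "(f \<longlongrightarrow> l) F"
  shows "((\<lambda>x. stereo (f x)) \<longlongrightarrow> stereo l) F"
proof (rule iffD2[OF tendsto_dist_iff])
  have eq: "dist (stereo p) (stereo q) = sqrt (2 - 2 * cos (dist p q))" for p q
  proof -
    have "stereo p \<bullet> stereo p = 1" "stereo q \<bullet> stereo q = 1"
      using norm_stereo by (simp_all add: norm_eq_1)
    moreover have "cos (dist p q) = stereo p \<bullet> stereo q"
      unfolding dist_riemann_sphere_def using inner_stereo_abs_le by (rule cos_arccos_abs)
    ultimately show ?thesis
      by (simp add: dist_norm norm_eq_sqrt_inner inner_diff inner_commute)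
  qed
  have "((\<lambda>x. dist (f x) l) \<longlongrightarrow> 0) F"
    using assms by (rule iffD1[OF tendsto_dist_iff])
  then have "((\<lambda>x. sqrt (2 - 2 * cos (dist (f x) l))) \<longlongrightarrow> sqrt (2 - 2 * cos 0)) F"
    by (intro tendsto_intros isCont_tendsto_compose[OF isCont_cos])
  then show "((\<lambda>x. dist (stereo (f x)) (stereo l)) \<longlongrightarrow> 0) F"
    by (simp add: eq)
qed

lemma continuous_on_hproj: "continuous_on (- {0}) hproj"
proof -
  have "((\<lambda>w. stereo (hproj w)) \<longlongrightarrow> stereo (hproj v)) (at v within - {0})" if "v \<noteq> 0" for v
  proof -
    let ?s = "\<lambda>v. ((2 / ((cmod (fst v))\<^sup>2 + (cmod (snd v))\<^sup>2)) *\<^sub>R (fst v * cnj (snd v)),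
     ((cmod (fst v))\<^sup>2 - (cmod (snd v))\<^sup>2) / ((cmod (fst v))\<^sup>2 + (cmod (snd v))\<^sup>2))"
    have "(?s \<longlongrightarrow> ?s v) (at v within - {0})"
      using that by (intro tendsto_intros) (auto simp: prod_eq_iff sum_power2_eq_zero_iff)
    moreover have "\<forall>\<^sub>F w in at v within - {0}. stereo (hproj w) = ?s w"
      by (intro eventually_at_topological[THEN iffD2] exI[of _ UNIV])
        (simp add: stereo_hproj del: stereo.simps)
    ultimately show ?thesis
      unfolding stereo_hproj[OF that] by (simp add: tendsto_cong)
  qed
  then show ?thesis
    unfolding continuous_on_def by (auto intro: tendsto_stereoD)
qed

section \<open>Brackets of vectors and coordinates of points\<close>

text \<open>The determinant of the two vectors. It vanishes exactly when they are linearly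
  dependent, that is, for nonzero vectors, when they represent the same point.\<close>

definition bracket :: "complex \<times> complex \<Rightarrow> complex \<times> complex \<Rightarrow> complex" where
  "bracket v w = fst v * snd w - snd v * fst w"

definition scale2 :: "complex \<Rightarrow> complex \<times> complex \<Rightarrow> complex \<times> complex" where
  "scale2 c v = (c * fst v, c * snd v)"

lemma hproj_scale2: "c \<noteq> 0 \<Longrightarrow> hproj (scale2 c v) = hproj v"
  by (simp add: hproj_def scale2_def)

lemma hproj_eq_iff:
  assumes "v \<noteq> 0" "w \<noteq> 0"
  shows "hproj v = hproj w \<longleftrightarrow> bracket v w = 0"
  using assms by (cases v; cases w) (auto simp: hproj_def bracket_def zero_prod_def field_simps)

definition affine_coord :: "riemann_sphere \<Rightarrow> complex" where
  "affine_coord p = (case p of Fin z \<Rightarrow> z | Infty \<Rightarrow> 0)"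

text \<open>The chart at infinity. The value 0 at \<open>Infty\<close> is genuine, while the value
  \<open>inverse 0 = 0\<close> at \<open>Fin 0\<close> is a default outside the chart.\<close>

definition inverse_coord :: "riemann_sphere \<Rightarrow> complex" where
  "inverse_coord p = (case p of Fin z \<Rightarrow> inverse z | Infty \<Rightarrow> 0)"

text \<open>A section of \<open>hproj\<close>, discontinuous at \<open>Infty\<close>. It enters only
  expressions that are invariant under scaling, or whose vanishing is.\<close>

definition homog :: "riemann_sphere \<Rightarrow> complex \<times> complex" where
  "homog p = (case p of Fin z \<Rightarrow> (z, 1) | Infty \<Rightarrow> (1, 0))"

lemma homog_neq_0: "homog p \<noteq> 0"
  by (cases p) (auto simp: homog_def zero_prod_def)

lemma hproj_homog: "hproj (homog p) = p"
  by (cases p) (auto simp: homog_def hproj_def)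

lemma homog_hproj:
  assumes "v \<noteq> 0"
  obtains c where "c \<noteq> 0" "v = scale2 c (homog (hproj v))"
proof (cases "snd v = 0")
  case True
  then show ?thesis
    using assms by (intro that[of "fst v"]) (auto simp: homog_def hproj_def scale2_def prod_eq_iff)
next
  case False
  then show ?thesis
    by (intro that[of "snd v"]) (auto simp: homog_def hproj_def scale2_def prod_eq_iff)
qed

section \<open>Holomorphic maps into the sphere\<close>

text \<open>Local holomorphic coordinates without common zeros treat poles like any other points.
  Unlike \<open>meromorphic_map_on\<close>, this admits the constant \<open>Infty\<close>, as is
  required for limits.\<close>

definition sphere_holomorphic_on :: "(complex \<Rightarrow> riemann_sphere) \<Rightarrow> complex set \<Rightarrow> bool" where
  "sphere_holomorphic_on f S \<longleftrightarrow>
     (\<forall>z\<in>S. \<exists>U A B. open U \<and> z \<in> U \<and> A holomorphic_on U \<and> B holomorphic_on U \<and>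
        (\<forall>w\<in>U. (A w, B w) \<noteq> 0 \<and> f w = hproj (A w, B w)))"

lemma sphere_holomorphic_onE:
  assumes "sphere_holomorphic_on f S" "z \<in> S" "open V" "z \<in> V"
  obtains r A B where "r > 0" "ball z r \<subseteq> V" "A holomorphic_on ball z r" "B holomorphic_on ball z r"
    "\<And>w. w \<in> ball z r \<Longrightarrow> (A w, B w) \<noteq> 0" "\<And>w. w \<in> ball z r \<Longrightarrow> f w = hproj (A w, B w)"
proof -
  obtain U A B where U: "open U" "z \<in> U" "A holomorphic_on U" "B holomorphic_on U"
    "\<And>w. w \<in> U \<Longrightarrow> (A w, B w) \<noteq> 0 \<and> f w = hproj (A w, B w)"
    using bspec[OF assms(1)[unfolded sphere_holomorphic_on_def] assms(2)] by metis
  have "open (U \<inter> V)" "z \<in> U \<inter> V" using U assms by auto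
  then obtain r where r: "r > 0" "ball z r \<subseteq> U \<inter> V"
    by (meson openE)
  with U show ?thesis
    by (intro that[of r A B]) (auto intro: holomorphic_on_subset)
qed

lemma sphere_holomorphic_on_continuous:
  assumes "sphere_holomorphic_on f S"
  shows "continuous_on S f"
proof (rule continuous_at_imp_continuous_on, rule ballI)
  fix z assume "z \<in> S"
  obtain r A B where r: "r > 0" and hol: "A holomorphic_on ball z r" "B holomorphic_on ball z r"
    and AB: "\<And>w. w \<in> ball z r \<Longrightarrow> (A w, B w) \<noteq> 0" "\<And>w. w \<in> ball z r \<Longrightarrow> f w = hproj (A w, B w)"
    by (rule sphere_holomorphic_onE[OF assms \<open>z \<in> S\<close> open_UNIV UNIV_I]) (rule that)
  have "continuous_on (ball z r) (\<lambda>w. (A w, B w))"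
    using hol by (intro continuous_intros holomorphic_on_imp_continuous_on)
  then have "continuous_on (ball z r) (\<lambda>w. hproj (A w, B w))"
    by (intro continuous_on_compose2[OF continuous_on_hproj]) (use AB in auto)
  then have "continuous_on (ball z r) f"
    by (rule continuous_on_eq) (simp add: AB(2))
  then show "isCont f z"
    using r by (simp add: continuous_on_interior)
qed

lemma sphere_holomorphic_on_compose:
  assumes f: "sphere_holomorphic_on f T" and h: "h holomorphic_on S" "h ` S \<subseteq> T" "open S"
  shows "sphere_holomorphic_on (f \<circ> h) S"
  unfolding sphere_holomorphic_on_def
proof
  fix z assume z: "z \<in> S"
  then have hz: "h z \<in> T" using h by blast
  obtain r A B where r: "r > 0" and hol: "A holomorphic_on ball (h z) r" "B holomorphic_on ball (h z) r"
    and AB: "\<And>w. w \<in> ball (h z) r \<Longrightarrow> (A w, B w) \<noteq> 0"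
      "\<And>w. w \<in> ball (h z) r \<Longrightarrow> f w = hproj (A w, B w)"
    by (rule sphere_holomorphic_onE[OF f hz open_UNIV UNIV_I]) (rule that)
  let ?U = "S \<inter> h -` ball (h z) r"
  have "open ?U"
    using h by (intro continuous_open_preimage holomorphic_on_imp_continuous_on) auto
  moreover have "h holomorphic_on ?U"
    using h(1) by (rule holomorphic_on_subset) blast
  then have "(\<lambda>w. A (h w)) holomorphic_on ?U" "(\<lambda>w. B (h w)) holomorphic_on ?U"
    by (rule holomorphic_on_compose_gen[OF _ hol(1), unfolded o_def]
          holomorphic_on_compose_gen[OF _ hol(2), unfolded o_def], blast)+
  ultimately show "\<exists>U A B. open U \<and> z \<in> U \<and> A holomorphic_on U \<and> B holomorphic_on U \<and>
        (\<forall>w\<in>U. (A w, B w) \<noteq> 0 \<and> (f \<circ> h) w = hproj (A w, B w))"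
    using z r AB
    by (intro exI[of _ ?U] exI[of _ "\<lambda>w. A (h w)"] exI[of _ "\<lambda>w. B (h w)"]) auto
qed

text \<open>The local coordinates are (g, 1) away from the poles of g and (1, 1/g) near a
  pole.\<close>

lemma meromorphic_map_on_imp_sphere_holomorphic_on:
  assumes "meromorphic_map_on f S" "open S"
  shows "sphere_holomorphic_on f S"
  unfolding sphere_holomorphic_on_def
proof
  fix z assume z: "z \<in> S"
  obtain g where g: "g nicely_meromorphic_on S"
    and fg: "\<And>z. z \<in> S \<Longrightarrow> f z = (if is_pole g z then Infty else Fin (g z))"
    using assms unfolding meromorphic_map_on_def by blast
  show "\<exists>U A B. open U \<and> z \<in> U \<and> A holomorphic_on U \<and> B holomorphic_on U \<and>
        (\<forall>w\<in>U. (A w, B w) \<noteq> 0 \<and> f w = hproj (A w, B w))"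
  proof (cases "is_pole g z")
    case False
    then have "g analytic_on {z}"
      by (rule nicely_meromorphic_on_imp_analytic_at[OF g z])
    then obtain V where V: "open V" "z \<in> V" "g holomorphic_on V"
      using analytic_at by blast
    then have "\<not> is_pole g w" if "w \<in> V" for w
      using that not_is_pole_holomorphic by blast
    then show ?thesis using V z \<open>open S\<close> fg
      by (intro exI[of _ "V \<inter> S"] exI[of _ g] exI[of _ "\<lambda>_. 1"])
        (auto simp: hproj_def zero_prod_def intro: holomorphic_on_subset)
  next
    case True
    \<comment> \<open>\<open>nicely_meromorphic_on\<close> gives \<open>g\<close> the value 0 at a
      pole, so \<open>inverse (g z) = 0\<close> is already the holomorphic extension of the
      reciprocal.\<close>
    have gz: "g z = 0"
      using g z True unfolding nicely_meromorphic_on_def is_pole_def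
      by (metis at_neq_bot not_tendsto_and_filterlim_at_infinity)
    have "g meromorphic_on {z}"
      using g z unfolding nicely_meromorphic_on_def by (auto intro: meromorphic_on_subset)
    then have "isolated_singularity_at g z"
      by (simp add: meromorphic_at_iff)
    then obtain r1 where r1: "r1 > 0" "g analytic_on ball z r1 - {z}"
      unfolding isolated_singularity_at_def by blast
    have "\<forall>\<^sub>F w in at z. g w \<noteq> 0" using True by (rule non_zero_neighbour_pole)
    then obtain r2 where r2: "r2 > 0" "\<And>w. w \<noteq> z \<Longrightarrow> dist w z < r2 \<Longrightarrow> g w \<noteq> 0"
      by (auto simp: eventually_at)
    obtain r3 where r3: "r3 > 0" "ball z r3 \<subseteq> S"
      using \<open>open S\<close> z openE by blast
    define r where "r = min r1 (min r2 r3)"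
    have r: "r > 0" "ball z r \<subseteq> S" using r1 r2 r3 by (auto simp: r_def)
    have hol: "g holomorphic_on ball z r - {z}"
      using r1 by (auto simp: r_def intro: analytic_imp_holomorphic holomorphic_on_subset)
    have nz: "g w \<noteq> 0" if "w \<in> ball z r - {z}" for w
      using that r2 by (auto simp: r_def dist_commute)
    have "(\<lambda>w. if w = z then 0 else inverse (g w)) holomorphic_on ball z r"
      using hol True nz by (intro is_pole_inverse_holomorphic) auto
    then have "(\<lambda>w. inverse (g w)) holomorphic_on ball z r"
      by (rule holomorphic_transform) (use gz in auto)
    moreover have "\<not> is_pole g w" if "w \<in> ball z r - {z}" for w
      using not_is_pole_holomorphic[OF _ that hol] by (simp add: open_delete)
    then have "f w = hproj (1, inverse (g w))" if "w \<in> ball z r" for w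
      using that fg[of w] subsetD[OF r(2) that] nz[of w] True gz
      by (cases "w = z") (auto simp: hproj_def divide_inverse)
    ultimately show ?thesis using r(1)
      by (intro exI[of _ "ball z r"] exI[of _ "\<lambda>_. 1"] exI[of _ "\<lambda>w. inverse (g w)"])
        (auto simp: zero_prod_def)
  qed
qed

lemma isCont_nonzero_is_pole:
  assumes "isCont A z" "A z \<noteq> 0" "isCont B z" "B z = 0" "\<forall>\<^sub>F w in at z. B w \<noteq> (0::complex)"
  shows "is_pole (\<lambda>w. A w / B w) z"
  using assms by (intro is_pole_divide) (auto simp: filterlim_at isCont_def)

text \<open>Near each point the second coordinate either vanishes identically or has isolated zeros.
  So the set \<open>T\<close> of points near which \<open>f\<close> is constantly
  \<open>Infty\<close> is both open and closed in \<open>S\<close>, and by connectedness it is empty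
  or all of \<open>S\<close>. If it is empty, the local quotients of the coordinates give a
  meromorphic function.\<close>

lemma sphere_holomorphic_on_imp_meromorphic_map_on:
  assumes f: "sphere_holomorphic_on f S" and S: "open S" "connected S"
  shows "meromorphic_map_on f S \<or> (\<forall>z\<in>S. f z = Infty)"
proof -
  have local: "\<exists>A B. A analytic_on {z} \<and> B analytic_on {z} \<and>
      (\<forall>\<^sub>F w in nhds z. (A w, B w) \<noteq> 0 \<and> f w = hproj (A w, B w)) \<and>
      ((\<forall>\<^sub>F w in nhds z. f w = Infty) \<or> (\<forall>\<^sub>F w in at z. B w \<noteq> 0 \<and> f w \<noteq> Infty))"
    if z: "z \<in> S" for z
  proof -
    obtain r A B where r: "r > 0" and hol: "A holomorphic_on ball z r" "B holomorphic_on ball z r"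
      and AB: "\<And>w. w \<in> ball z r \<Longrightarrow> (A w, B w) \<noteq> 0" "\<And>w. w \<in> ball z r \<Longrightarrow> f w = hproj (A w, B w)"
      by (rule sphere_holomorphic_onE[OF f z open_UNIV UNIV_I]) (rule that)
    have "\<forall>\<^sub>F w in nhds z. w \<in> ball z r"
      using r by (intro eventually_nhds_in_open) auto
    note ev = this
    have "(\<forall>\<^sub>F w in nhds z. f w = Infty) \<or> (\<forall>\<^sub>F w in at z. B w \<noteq> 0 \<and> f w \<noteq> Infty)"
    proof (cases "\<forall>w\<in>ball z r. B w = 0")
      case True
      show ?thesis
        using ev by (intro disjI1, eventually_elim) (use True AB in \<open>auto simp: hproj_def\<close>)
    next
      case False
      then obtain b where "b \<in> ball z r" "B b \<noteq> 0" by blast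
      then have "\<forall>\<^sub>F w in at z. B w \<noteq> 0 \<and> w \<in> ball z r"
        using r hol(2) by (intro non_zero_neighbour_alt) auto
      then have "\<forall>\<^sub>F w in at z. B w \<noteq> 0 \<and> f w \<noteq> Infty"
        by eventually_elim (use AB in \<open>auto simp: hproj_def\<close>)
      then show ?thesis ..
    qed
    moreover have "\<forall>\<^sub>F w in nhds z. (A w, B w) \<noteq> 0 \<and> f w = hproj (A w, B w)"
      using ev by eventually_elim (use AB in auto)
    ultimately show ?thesis
      using hol r by (intro exI[of _ A] exI[of _ B]) (auto simp: analytic_at intro!: exI[of _ "ball z r"])
  qed
  define T where "T = {z \<in> S. \<forall>\<^sub>F w in nhds z. f w = Infty}"
  have "openin (top_of_set S) T"
  proof -
    have "open {z. \<forall>\<^sub>F w in nhds z. f w = Infty}"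
      unfolding eventually_nhds by (subst open_subopen) blast
    then show ?thesis
      unfolding T_def using S by (auto simp: openin_open)
  qed
  moreover have "openin (top_of_set S) (S - T)"
  proof (subst openin_subopen, rule ballI)
    fix z assume z: "z \<in> S - T"
    then have "\<forall>\<^sub>F w in at z. f w \<noteq> Infty"
      using local[of z] by (auto simp: T_def elim: eventually_mono)
    then obtain U where U: "open U" "z \<in> U" "\<And>w. w \<in> U \<Longrightarrow> w \<noteq> z \<Longrightarrow> f w \<noteq> Infty"
      by (auto simp: eventually_at_topological)
    have "w \<notin> T" if "w \<in> U" "w \<noteq> z" for w
      using U(3)[OF that] eventually_nhds_x_imp_x by (auto simp: T_def)
    then have "S \<inter> U \<subseteq> S - T" using z by auto
    moreover have "openin (top_of_set S) (S \<inter> U)" using U by auto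
    ultimately show "\<exists>T'. openin (top_of_set S) T' \<and> z \<in> T' \<and> T' \<subseteq> S - T"
      using U z by blast
  qed
  ultimately have "T = {} \<or> T = S"
    using S(2) by (simp add: connected_clopen closedin_def) (metis openin_imp_subset)
  then show ?thesis
  proof
    assume "T = S"
    then show ?thesis using eventually_nhds_x_imp_x by (fastforce simp: T_def)
  next
    assume T: "T = {}"
    \<comment> \<open>The default value 0 of \<open>affine_coord\<close> at \<open>Infty\<close> is
      the one that \<open>nicely_meromorphic_on\<close> demands at a pole.\<close>
    define g where "g z = affine_coord (f z)" for z
    have g: "g meromorphic_on {z} \<and>
        (if f z = Infty then is_pole g z \<and> g z = 0 else g \<midarrow>z\<rightarrow> g z \<and> f z = Fin (g z))"
      if z: "z \<in> S" for z
    proof -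
      obtain A B where an: "A analytic_on {z}" "B analytic_on {z}"
        and AB: "\<forall>\<^sub>F w in nhds z. (A w, B w) \<noteq> 0 \<and> f w = hproj (A w, B w)"
        and nz: "\<forall>\<^sub>F w in at z. B w \<noteq> 0 \<and> f w \<noteq> Infty"
        using local[OF z] T z by (auto simp: T_def)
      have gq: "\<forall>\<^sub>F w in nhds z. g w = A w / B w"
        using AB by eventually_elim (auto simp: g_def hproj_def affine_coord_def)
      then have gq': "\<forall>\<^sub>F w in at z. g w = A w / B w" and gz: "g z = A z / B z"
        by (auto simp: eventually_at_filter elim: eventually_mono dest: eventually_nhds_x_imp_x)
      have ABz: "(A z, B z) \<noteq> 0" "f z = hproj (A z, B z)"
        using AB eventually_nhds_x_imp_x by force+
      have cont: "isCont A z" "isCont B z"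
        using an by (auto intro: analytic_at_imp_isCont)
      have "(\<lambda>w. A w / B w) meromorphic_on {z}"
        using an by (intro meromorphic_intros analytic_on_imp_meromorphic_on)
      then have "g meromorphic_on {z}"
        using gq' by (subst meromorphic_on_cong[OF _ refl]) auto
      moreover have "is_pole g z \<and> g z = 0" if "f z = Infty"
      proof -
        have "B z = 0" using ABz that by (auto simp: hproj_def split: if_splits)
        moreover from this have "A z \<noteq> 0" using ABz by (auto simp: zero_prod_def)
        ultimately have "is_pole (\<lambda>w. A w / B w) z"
          using cont nz by (intro isCont_nonzero_is_pole) (auto elim: eventually_mono)
        then show ?thesis using gz \<open>B z = 0\<close> is_pole_cong[OF gq' refl] by simp
      qed
      moreover have "g \<midarrow>z\<rightarrow> g z \<and> f z = Fin (g z)" if "f z \<noteq> Infty"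
      proof -
        have "B z \<noteq> 0" using ABz that by (auto simp: hproj_def split: if_splits)
        then have "(\<lambda>w. A w / B w) \<midarrow>z\<rightarrow> A z / B z"
          using cont by (intro tendsto_intros) (auto simp: isCont_def)
        then have "g \<midarrow>z\<rightarrow> g z" using gq' by (simp add: gz tendsto_cong)
        moreover have "f z = Fin (g z)"
          using ABz that by (auto simp: gz hproj_def)
        ultimately show ?thesis by blast
      qed
      ultimately show ?thesis by auto
    qed
    have "g nicely_meromorphic_on S"
      unfolding nicely_meromorphic_on_def meromorphic_on_meromorphic_at[of g S]
      using g by (metis (full_types))
    moreover have "f z = (if is_pole g z then Infty else Fin (g z))" if "z \<in> S" for z
      using g[OF that] not_tendsto_and_filterlim_at_infinity[of "at z" g "g z"]
      by (auto simp: is_pole_def split: if_splits)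
    ultimately show ?thesis
      unfolding meromorphic_map_on_def by blast
  qed
qed

section \<open>The two affine charts\<close>

lemma continuous_on_stereo: "continuous_on S stereo"
  unfolding continuous_on_def by (auto intro: tendsto_stereo tendsto_ident_at)

text \<open>This chart is stereographic projection from the north pole, an explicit continuous
  function of \<open>stereo p\<close>.\<close>

lemma continuous_on_affine_coord: "continuous_on (- {Infty}) affine_coord"
proof -
  have eq: "snd (stereo p) \<noteq> 1 \<and> fst (stereo p) /\<^sub>R (1 - snd (stereo p)) = affine_coord p"
    if p: "p \<noteq> Infty" for p
  proof (cases p)
    case (Fin z)
    define c where "c = 2 / (1 + (cmod z)\<^sup>2)"
    have pos: "(cmod z)\<^sup>2 + 1 > 0" by (simp add: add_nonneg_pos)
    then have "c \<noteq> 0" by (simp add: c_def)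
    moreover have "1 - snd (stereo p) = c"
      using pos by (simp add: Fin c_def field_simps)
    moreover have "fst (stereo p) = c *\<^sub>R z"
      by (simp add: Fin c_def)
    ultimately have "fst (stereo p) /\<^sub>R (1 - snd (stereo p)) = affine_coord p \<and> 1 - snd (stereo p) \<noteq> 0"
      by (simp add: Fin affine_coord_def del: stereo.simps)
    then show ?thesis by auto
  qed (use p in simp)
  have "continuous_on (- {Infty}) (\<lambda>p. fst (stereo p) /\<^sub>R (1 - snd (stereo p)))"
    using eq by (intro continuous_intros continuous_on_stereo) auto
  then show ?thesis
    by (rule continuous_on_eq) (use eq in auto)
qed

text \<open>This chart is the complex conjugate of stereographic projection from the south
  pole.\<close>

lemma continuous_on_inverse_coord: "continuous_on (- {Fin 0}) inverse_coord"
proof -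
  have eq: "snd (stereo p) \<noteq> - 1 \<and> cnj (fst (stereo p)) /\<^sub>R (1 + snd (stereo p)) = inverse_coord p"
    if p: "p \<noteq> Fin 0" for p
  proof (cases p)
    case (Fin z)
    have z: "z \<noteq> 0" using Fin p by auto
    define c where "c = 2 / (1 + (cmod z)\<^sup>2)"
    have pos: "(cmod z)\<^sup>2 + 1 > 0" by (simp add: add_nonneg_pos)
    then have c: "c \<noteq> 0" by (simp add: c_def)
    have 1: "1 + snd (stereo p) = c * (cmod z)\<^sup>2"
      using pos by (simp add: Fin c_def field_simps)
    have "fst (stereo p) = c *\<^sub>R z"
      by (simp add: Fin c_def)
    then have "cnj (fst (stereo p)) /\<^sub>R (1 + snd (stereo p)) = cnj z /\<^sub>R (cmod z)\<^sup>2"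
      using c by (simp add: 1)
    also have "\<dots> = inverse z"
      using z by (simp add: scaleR_conv_of_real complex_norm_square field_simps flip: of_real_power)
    finally have "cnj (fst (stereo p)) /\<^sub>R (1 + snd (stereo p)) = inverse_coord p"
      by (simp add: Fin inverse_coord_def)
    moreover have "1 + snd (stereo p) \<noteq> 0"
      using 1 z c by simp
    ultimately show ?thesis by auto
  qed (simp add: inverse_coord_def)
  have "continuous_on (- {Fin 0}) (\<lambda>p. cnj (fst (stereo p)) /\<^sub>R (1 + snd (stereo p)))"
    using eq by (intro continuous_intros continuous_on_stereo) (auto simp: add_eq_0_iff)
  then show ?thesis
    by (rule continuous_on_eq) (use eq in auto)
qed

text \<open>In local coordinates the two functions are A / B and B / A, and omitting the excluded
  value means that the denominator has no zero.\<close>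

lemma holomorphic_on_coords:
  assumes f: "sphere_holomorphic_on f S" and S: "open S"
  shows "f ` S \<subseteq> - {Infty} \<Longrightarrow> (\<lambda>z. affine_coord (f z)) holomorphic_on S"
    and "f ` S \<subseteq> - {Fin 0} \<Longrightarrow> (\<lambda>z. inverse_coord (f z)) holomorphic_on S"
proof -
  have local: "\<exists>r>0. ball z r \<subseteq> S \<and> (\<exists>A B. A holomorphic_on ball z r \<and> B holomorphic_on ball z r \<and>
      (\<forall>w\<in>ball z r. (A w, B w) \<noteq> 0 \<and> f w = hproj (A w, B w)))" if z: "z \<in> S" for z
  proof -
    obtain r A B where "r > 0" "ball z r \<subseteq> S" "A holomorphic_on ball z r" "B holomorphic_on ball z r"
      "\<And>w. w \<in> ball z r \<Longrightarrow> (A w, B w) \<noteq> 0" "\<And>w. w \<in> ball z r \<Longrightarrow> f w = hproj (A w, B w)"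
      by (rule sphere_holomorphic_onE[OF f z S z]) (rule that)
    then show ?thesis by blast
  qed
  show "(\<lambda>z. affine_coord (f z)) holomorphic_on S" if fS: "f ` S \<subseteq> - {Infty}"
  proof (rule analytic_imp_holomorphic, unfold analytic_on_def, rule ballI)
    fix z assume "z \<in> S"
    then obtain r A B where r: "r > 0" "ball z r \<subseteq> S"
      and hol: "A holomorphic_on ball z r" "B holomorphic_on ball z r"
      and AB: "\<forall>w\<in>ball z r. (A w, B w) \<noteq> 0 \<and> f w = hproj (A w, B w)"
      using local by metis
    have B: "B w \<noteq> 0 \<and> affine_coord (f w) = A w / B w" if "w \<in> ball z r" for w
    proof -
      have "f w \<noteq> Infty" using fS r that by blast
      then show ?thesis using AB that by (auto simp: hproj_def affine_coord_def split: if_splits)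
    qed
    have "(\<lambda>w. A w / B w) holomorphic_on ball z r"
      using B by (intro holomorphic_on_divide hol) auto
    then have "(\<lambda>z. affine_coord (f z)) holomorphic_on ball z r"
      by (rule holomorphic_transform) (use B in auto)
    then show "\<exists>e>0. (\<lambda>z. affine_coord (f z)) holomorphic_on ball z e"
      using r by blast
  qed
  show "(\<lambda>z. inverse_coord (f z)) holomorphic_on S" if fS: "f ` S \<subseteq> - {Fin 0}"
  proof (rule analytic_imp_holomorphic, unfold analytic_on_def, rule ballI)
    fix z assume "z \<in> S"
    then obtain r A B where r: "r > 0" "ball z r \<subseteq> S"
      and hol: "A holomorphic_on ball z r" "B holomorphic_on ball z r"
      and AB: "\<forall>w\<in>ball z r. (A w, B w) \<noteq> 0 \<and> f w = hproj (A w, B w)"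
      using local by metis
    have A: "A w \<noteq> 0 \<and> inverse_coord (f w) = B w / A w" if "w \<in> ball z r" for w
    proof -
      have "f w \<noteq> Fin 0" using fS r that by blast
      then show ?thesis using AB that
        by (auto simp: hproj_def inverse_coord_def zero_prod_def split: if_splits)
    qed
    have "(\<lambda>w. B w / A w) holomorphic_on ball z r"
      using A by (intro holomorphic_on_divide hol) auto
    then have "(\<lambda>z. inverse_coord (f z)) holomorphic_on ball z r"
      by (rule holomorphic_transform) (use A in auto)
    then show "\<exists>e>0. (\<lambda>z. inverse_coord (f z)) holomorphic_on ball z e"
      using r by blast
  qed
qed

lemma sphere_holomorphic_on_subset:
  "sphere_holomorphic_on f S \<Longrightarrow> T \<subseteq> S \<Longrightarrow> sphere_holomorphic_on f T"
  unfolding sphere_holomorphic_on_def by (meson subsetD)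

text \<open>Close to \<open>\<zeta>\<close> the map avoids every given value other than
  \<open>p\<close>. It thus avoids \<open>Infty\<close> if \<open>p\<close> is finite and
  \<open>Fin 0\<close> if \<open>p\<close> is \<open>Infty\<close>, so a single chart supplies
  coordinates on all of \<open>S \<inter> ball \<zeta> \<delta>\<close>, with a nonzero limit at
  \<open>\<zeta>\<close>.\<close>

lemma boundary_coordinates:
  assumes \<psi>: "sphere_holomorphic_on \<psi> S" and S: "open S" "\<zeta> \<notin> S"
    and lim: "(\<psi> \<longlongrightarrow> p) (at \<zeta> within S)"
  obtains a b v \<delta> where "\<delta> > 0" "a holomorphic_on S \<inter> ball \<zeta> \<delta>" "b holomorphic_on S \<inter> ball \<zeta> \<delta>"
    "\<And>z. z \<in> S \<inter> ball \<zeta> \<delta> \<Longrightarrow> (a z, b z) \<noteq> 0" "\<And>z. z \<in> S \<inter> ball \<zeta> \<delta> \<Longrightarrow> hproj (a z, b z) = \<psi> z"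
    "((\<lambda>z. (a z, b z)) \<longlongrightarrow> v) (at \<zeta> within S)" "v \<noteq> 0" "hproj v = p"
proof -
  have *: "\<exists>\<delta>>0. \<psi> ` (S \<inter> ball \<zeta> \<delta>) \<subseteq> - {q}" if "q \<noteq> p" for q
  proof -
    have "\<forall>\<^sub>F z in at \<zeta> within S. \<psi> z \<in> - {q}"
      using that by (intro topological_tendstoD[OF lim]) auto
    then show ?thesis
      using S by (fastforce simp: eventually_at dist_commute)
  qed
  show ?thesis
  proof (cases "p = Infty")
    case False
    then obtain \<delta> where \<delta>: "\<delta> > 0" "\<psi> ` (S \<inter> ball \<zeta> \<delta>) \<subseteq> - {Infty}"
      using * by metis
    have "sphere_holomorphic_on \<psi> (S \<inter> ball \<zeta> \<delta>)"
      by (rule sphere_holomorphic_on_subset[OF \<psi>]) auto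
    then have hol: "(\<lambda>z. affine_coord (\<psi> z)) holomorphic_on S \<inter> ball \<zeta> \<delta>"
      using \<delta> S by (intro holomorphic_on_coords) auto
    have ne: "\<psi> z \<noteq> Infty" if "z \<in> S \<inter> ball \<zeta> \<delta>" for z
      using \<delta>(2) that by blast
    have eq: "hproj (affine_coord q, 1) = q" if "q \<noteq> Infty" for q
      using that by (cases q) (auto simp: hproj_def affine_coord_def)
    have "isCont affine_coord p"
      using continuous_on_affine_coord False
      by (simp add: continuous_on_eq_continuous_at[OF open_Compl[OF closed_singleton]])
    then have "((\<lambda>z. affine_coord (\<psi> z)) \<longlongrightarrow> affine_coord p) (at \<zeta> within S)"
      using lim by (rule isCont_tendsto_compose)
    then have "((\<lambda>z. (affine_coord (\<psi> z), 1)) \<longlongrightarrow> (affine_coord p, 1)) (at \<zeta> within S)"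
      by (intro tendsto_intros)
    then show ?thesis
      by (intro that[OF \<delta>(1) hol, of "\<lambda>_. 1"]) (use ne False eq in \<open>auto simp: zero_prod_def\<close>)
  next
    case True
    then obtain \<delta> where \<delta>: "\<delta> > 0" "\<psi> ` (S \<inter> ball \<zeta> \<delta>) \<subseteq> - {Fin 0}"
      using * by (metis riemann_sphere.distinct(1))
    have "sphere_holomorphic_on \<psi> (S \<inter> ball \<zeta> \<delta>)"
      by (rule sphere_holomorphic_on_subset[OF \<psi>]) auto
    then have hol: "(\<lambda>z. inverse_coord (\<psi> z)) holomorphic_on S \<inter> ball \<zeta> \<delta>"
      using \<delta> S by (intro holomorphic_on_coords) auto
    have ne: "\<psi> z \<noteq> Fin 0" if "z \<in> S \<inter> ball \<zeta> \<delta>" for z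
      using \<delta>(2) that by blast
    have eq: "hproj (1, inverse_coord q) = q" if "q \<noteq> Fin 0" for q
      using that by (cases q) (auto simp: hproj_def inverse_coord_def divide_inverse)
    have "isCont inverse_coord p"
      using continuous_on_inverse_coord True
      by (simp add: continuous_on_eq_continuous_at[OF open_Compl[OF closed_singleton]])
    then have "((\<lambda>z. inverse_coord (\<psi> z)) \<longlongrightarrow> inverse_coord p) (at \<zeta> within S)"
      using lim by (rule isCont_tendsto_compose)
    then have "((\<lambda>z. (1, inverse_coord (\<psi> z))) \<longlongrightarrow> (1, inverse_coord p)) (at \<zeta> within S)"
      by (intro tendsto_intros)
    then show ?thesis
      by (intro that[OF \<delta>(1) holomorphic_on_const[of 1] hol])
        (use ne True eq in \<open>auto simp: zero_prod_def\<close>)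
  qed
qed

section \<open>The cross ratio and its inversion\<close>

text \<open>In affine coordinates this is (x - u)(w - v) / ((x - v)(w - u)), the Moebius map in x
  that sends u, v, w to 0, infinity, 1.\<close>

definition cross_ratio where
  "cross_ratio x u v w = bracket x u * bracket w v / (bracket x v * bracket w u)"

lemma cross_ratio_scale2: "c \<noteq> 0 \<Longrightarrow> cross_ratio (scale2 c x) u v w = cross_ratio x u v w"
proof -
  assume "c \<noteq> 0"
  have "bracket (scale2 c x) y = c * bracket x y" for y
    by (simp add: bracket_def scale2_def algebra_simps)
  then show ?thesis
    using \<open>c \<noteq> 0\<close> by (simp add: cross_ratio_def mult.assoc)
qed

text \<open>The value 1 is excluded by the Pluecker relation: numerator minus denominator equals
  \<open>bracket x w * bracket u v\<close>.\<close>

lemma cross_ratio_omits: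
  assumes "bracket x u \<noteq> 0" "bracket x v \<noteq> 0" "bracket x w \<noteq> 0"
    "bracket w u \<noteq> 0" "bracket w v \<noteq> 0" "bracket u v \<noteq> 0"
  shows "cross_ratio x u v w \<noteq> 0" "cross_ratio x u v w \<noteq> 1"
proof -
  show "cross_ratio x u v w \<noteq> 0" using assms by (simp add: cross_ratio_def)
  have "bracket x u * bracket w v - bracket x v * bracket w u = bracket x w * bracket u v"
    by (simp add: bracket_def algebra_simps)
  moreover have "bracket x w * bracket u v \<noteq> 0" using assms by simp
  ultimately have "bracket x u * bracket w v \<noteq> bracket x v * bracket w u"
    by (metis cancel_comm_monoid_add_class.diff_cancel)
  then show "cross_ratio x u v w \<noteq> 1" using assms by (simp add: cross_ratio_def)
qed

definition comb :: "complex \<Rightarrow> complex \<times> complex \<Rightarrow> complex \<Rightarrow> complex \<times> complex \<Rightarrow> complex \<times> complex" where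
  "comb s u t v = (s * fst u - t * fst v, s * snd u - t * snd v)"

text \<open>The pair (X, kY) is a multiple, by the factor \<open>m\<close>, of the pair of brackets
  of \<open>x\<close> with \<open>u\<close> and \<open>v\<close>. Cramer's rule, [x u] v - [x v] u =
  -[u v] x, then recovers \<open>x\<close> up to the scalar \<open>c\<close>.\<close>

lemma hproj_of_cross_ratio:
  assumes "bracket x v \<noteq> 0" "bracket w u \<noteq> 0" "bracket w v \<noteq> 0" "bracket u v \<noteq> 0"
    and "Y \<noteq> 0" "cross_ratio x u v w = X / Y"
  shows "hproj x = hproj (comb X v (bracket w v / bracket w u * Y) u)"
proof -
  define k where "k = bracket w v / bracket w u"
  define m where "m = k * Y / bracket x v"
  define c where "c = - (m * bracket u v)"
  have "c \<noteq> 0" using assms by (simp add: c_def m_def k_def)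
  have X: "X = m * bracket x u"
    using assms by (simp add: cross_ratio_def k_def m_def field_simps)
  have kY: "k * Y = m * bracket x v"
    using assms by (simp add: m_def)
  have "comb X v (k * Y) u = scale2 c x"
    unfolding comb_def scale2_def X kY c_def by (simp add: bracket_def algebra_simps)
  then show ?thesis
    using \<open>c \<noteq> 0\<close> by (simp add: hproj_scale2 flip: k_def)
qed

lemma comb_neq_0:
  assumes "bracket u v \<noteq> 0" "s \<noteq> 0 \<or> t \<noteq> 0"
  shows "comb s v t u \<noteq> 0"
proof
  assume "comb s v t u = 0"
  then have 0: "s * fst v = t * fst u" "s * snd v = t * snd u"
    by (auto simp: comb_def zero_prod_def)
  have "s * bracket u v = fst u * (s * snd v) - snd u * (s * fst v)"
    by (simp add: bracket_def algebra_simps)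
  also have "\<dots> = 0" by (simp add: 0)
  finally have "s * bracket u v = 0" .
  moreover have "t * bracket u v = (t * fst u) * snd v - (t * snd u) * fst v"
    by (simp add: bracket_def algebra_simps)
  then have "t * bracket u v = 0" by (simp flip: 0)
  ultimately have "s * bracket u v = 0 \<and> t * bracket u v = 0" ..
  then show False using assms by simp
qed

subsection \<open>Sequences approaching the boundary\<close>

text \<open>The map \<open>homog (f z)\<close> need not be holomorphic. Locally it differs from
  holomorphic coordinates of \<open>f\<close> by a nonzero scalar, which the cross ratio
  ignores.\<close>

lemma holomorphic_on_cross_ratio:
  assumes f: "sphere_holomorphic_on f S" and S: "open S"
    and hol: "a1 holomorphic_on S" "b1 holomorphic_on S" "a2 holomorphic_on S" "b2 holomorphic_on S"
      "a3 holomorphic_on S" "b3 holomorphic_on S"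
    and nz: "\<And>z. z \<in> S \<Longrightarrow> bracket (homog (f z)) (a2 z, b2 z) \<noteq> 0"
      "\<And>z. z \<in> S \<Longrightarrow> bracket (a3 z, b3 z) (a1 z, b1 z) \<noteq> 0"
  shows "(\<lambda>z. cross_ratio (homog (f z)) (a1 z, b1 z) (a2 z, b2 z) (a3 z, b3 z)) holomorphic_on S"
proof (rule analytic_imp_holomorphic, unfold analytic_on_def, rule ballI)
  fix z assume z: "z \<in> S"
  obtain r A B where r: "r > 0" "ball z r \<subseteq> S"
    and AB: "A holomorphic_on ball z r" "B holomorphic_on ball z r"
      "\<And>w. w \<in> ball z r \<Longrightarrow> (A w, B w) \<noteq> 0" "\<And>w. w \<in> ball z r \<Longrightarrow> f w = hproj (A w, B w)"
    by (rule sphere_holomorphic_onE[OF f z S z]) (rule that)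
  have sc: "\<exists>c. c \<noteq> 0 \<and> (A w, B w) = scale2 c (homog (f w))" if "w \<in> ball z r" for w
    using homog_hproj[OF AB(3)[OF that]] AB(4)[OF that] by metis
  have eq: "cross_ratio (homog (f w)) u v x = cross_ratio (A w, B w) u v x" if "w \<in> ball z r" for w u v x
    using sc[OF that] cross_ratio_scale2 by metis
  have nz': "bracket (A w, B w) (a2 w, b2 w) \<noteq> 0" if w: "w \<in> ball z r" for w
  proof -
    obtain c where c: "c \<noteq> 0" "(A w, B w) = scale2 c (homog (f w))" using sc[OF w] by blast
    then have "bracket (A w, B w) (a2 w, b2 w) = c * bracket (homog (f w)) (a2 w, b2 w)"
      by (simp add: bracket_def scale2_def algebra_simps)
    then show ?thesis using c nz(1)[of w] w r by auto
  qed
  have hol': "a1 holomorphic_on ball z r" "b1 holomorphic_on ball z r" "a2 holomorphic_on ball z r"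
    "b2 holomorphic_on ball z r" "a3 holomorphic_on ball z r" "b3 holomorphic_on ball z r"
    using hol r(2) by (blast intro: holomorphic_on_subset)+
  have "(\<lambda>w. cross_ratio (A w, B w) (a1 w, b1 w) (a2 w, b2 w) (a3 w, b3 w)) holomorphic_on ball z r"
    unfolding cross_ratio_def
  proof (rule holomorphic_on_divide)
    fix w assume "w \<in> ball z r"
    then show "bracket (A w, B w) (a2 w, b2 w) * bracket (a3 w, b3 w) (a1 w, b1 w) \<noteq> 0"
      using nz' nz(2)[of w] r(2) by auto
  qed (unfold bracket_def fst_conv snd_conv, (intro holomorphic_intros AB hol')+)
  then have "(\<lambda>w. cross_ratio (homog (f w)) (a1 w, b1 w) (a2 w, b2 w) (a3 w, b3 w)) holomorphic_on ball z r"
    by (rule holomorphic_transform) (simp add: eq)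
  then show "\<exists>e>0. (\<lambda>w. cross_ratio (homog (f w)) (a1 w, b1 w) (a2 w, b2 w) (a3 w, b3 w)) holomorphic_on ball z e"
    using r(1) by blast
qed

text \<open>The expression is one function of the tuple of all varying data, continuous on the open
  set where \<open>comb\<close> does not vanish, and the limit tuple maps \<open>K\<close> onto a
  compact subset of that set.\<close>

lemma uniform_limit_hproj_comb:
  assumes X: "uniform_limit K X H0 F" and Y: "uniform_limit K Y H1 F"
    and u: "uniform_limit K u (\<lambda>_. u0) F" and v: "uniform_limit K v (\<lambda>_. v0) F"
    and k: "uniform_limit K k (\<lambda>_. k0) F"
    and K: "compact K" "continuous_on K H0" "continuous_on K H1"
    and nz: "\<And>z. z \<in> K \<Longrightarrow> comb (H0 z) v0 (k0 * H1 z) u0 \<noteq> 0"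
  shows "uniform_limit K (\<lambda>n z. hproj (comb (X n z) (v n z) (k n z * Y n z) (u n z)))
    (\<lambda>z. hproj (comb (H0 z) v0 (k0 * H1 z) u0)) F"
proof -
  define T where "T t = comb (fst (fst t)) (snd (snd (snd t))) (fst (snd t) * snd (fst t)) (fst (snd (snd t)))"
    for t :: "(complex \<times> complex) \<times> complex \<times> (complex \<times> complex) \<times> (complex \<times> complex)"
  have T: "continuous_on A T" for A
    unfolding T_def comb_def by (intro continuous_intros)
  let ?l = "\<lambda>z. ((H0 z, H1 z), k0, u0, v0)"
  have lim: "uniform_limit K (\<lambda>n z. ((X n z, Y n z), k n z, u n z, v n z)) ?l F"
    by (intro uniform_limit_Pair assms)
  have comp: "compact (?l ` K)"
    using K by (intro compact_continuous_image continuous_intros)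
  have opn: "open {t. T t \<noteq> 0}"
    using T by (intro open_Collect_neq continuous_on_const)
  have cont: "continuous_on {t. T t \<noteq> 0} (\<lambda>t. hproj (T t))"
    by (rule continuous_on_compose2[OF continuous_on_hproj T]) auto
  have sub: "?l ` K \<subseteq> {t. T t \<noteq> 0}"
    using nz by (auto simp: T_def)
  have "uniform_limit K (\<lambda>n z. hproj (T ((X n z, Y n z), k n z, u n z, v n z)))
      (\<lambda>z. hproj (T (?l z))) F"
    by (rule uniform_limit_compose_continuous_on_open[OF cont opn lim comp sub])
  then show ?thesis by (simp add: T_def)
qed

lemma strict_mono_eventually_diagonal:
  assumes "\<And>k. eventually (P k) sequentially"
  obtains s :: "nat \<Rightarrow> nat" where "strict_mono s" "\<And>k. P k (s k)"
proof -
  obtain N where N: "\<And>k n. n \<ge> N k \<Longrightarrow> P k n"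
    using assms unfolding eventually_sequentially by metis
  \<comment> \<open>The sum dominates \<open>N k\<close> and never decreases; the summand
    \<open>k\<close> makes the sequence strictly increasing.\<close>
  define s where "s k = k + (\<Sum>i\<le>k. N i)" for k
  have "strict_mono s"
    by (rule strict_monoI_Suc) (simp add: s_def)
  moreover have "N k \<le> s k" for k
    unfolding s_def using member_le_sum[of k "{..k}" N] by simp
  ultimately show ?thesis using N that by blast
qed

text \<open>The maps \<open>\<phi> n\<close> approach \<open>\<zeta>\<close> only locally uniformly,
  so none of them need send the whole disc into the neighbourhood where \<open>f\<close> omits the
  three functions. Shrinking the argument by factors tending to 1 gives maps \<open>\<eta> k\<close>
  that do; the shrinking is undone at the end.\<close>

proposition convergent_subsequence_near_boundary:
  fixes \<zeta> :: complex and \<phi> :: "nat \<Rightarrow> complex \<Rightarrow> complex"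
  defines "D \<equiv> ball (0 :: complex) 1"
  assumes f: "sphere_holomorphic_on f D"
    and \<psi>: "sphere_holomorphic_on \<psi>\<^sub>1 D" "sphere_holomorphic_on \<psi>\<^sub>2 D" "sphere_holomorphic_on \<psi>\<^sub>3 D"
    and \<zeta>: "\<zeta> \<notin> D"
    and lim: "(\<psi>\<^sub>1 \<longlongrightarrow> p\<^sub>1) (at \<zeta> within D)" "(\<psi>\<^sub>2 \<longlongrightarrow> p\<^sub>2) (at \<zeta> within D)" "(\<psi>\<^sub>3 \<longlongrightarrow> p\<^sub>3) (at \<zeta> within D)"
    and p: "p\<^sub>1 \<noteq> p\<^sub>2" "p\<^sub>1 \<noteq> p\<^sub>3" "p\<^sub>2 \<noteq> p\<^sub>3"
    and share: "\<And>z. z \<in> D \<Longrightarrow> \<psi>\<^sub>1 z = f z \<longleftrightarrow> \<psi>\<^sub>2 z = f z" "\<And>z. z \<in> D \<Longrightarrow> \<psi>\<^sub>2 z = f z \<longleftrightarrow> \<psi>\<^sub>3 z = f z"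
    and \<phi>: "\<And>n. \<phi> n holomorphic_on D" "\<And>n. \<phi> n ` D \<subseteq> D"
    and conv: "\<And>K. compact K \<Longrightarrow> K \<subseteq> D \<Longrightarrow> uniform_limit K \<phi> (\<lambda>_. \<zeta>) sequentially"
  obtains r g where "strict_mono (r :: nat \<Rightarrow> nat)" "sphere_holomorphic_on g D"
    "\<And>K. compact K \<Longrightarrow> K \<subseteq> D \<Longrightarrow> uniform_limit K (\<lambda>n z. f (\<phi> (r n) z)) g sequentially"
proof -
  have D: "open D" "connected D" "D \<noteq> {}" by (auto simp: D_def)
  obtain a1 b1 v1 \<delta>1 where 1: "\<delta>1 > 0" "a1 holomorphic_on D \<inter> ball \<zeta> \<delta>1" "b1 holomorphic_on D \<inter> ball \<zeta> \<delta>1"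
    "\<And>z. z \<in> D \<inter> ball \<zeta> \<delta>1 \<Longrightarrow> (a1 z, b1 z) \<noteq> 0" "\<And>z. z \<in> D \<inter> ball \<zeta> \<delta>1 \<Longrightarrow> hproj (a1 z, b1 z) = \<psi>\<^sub>1 z"
    "((\<lambda>z. (a1 z, b1 z)) \<longlongrightarrow> v1) (at \<zeta> within D)" "v1 \<noteq> 0" "hproj v1 = p\<^sub>1"
    by (rule boundary_coordinates[OF \<psi>(1) D(1) \<zeta> lim(1)]) (rule that)
  obtain a2 b2 v2 \<delta>2 where 2: "\<delta>2 > 0" "a2 holomorphic_on D \<inter> ball \<zeta> \<delta>2" "b2 holomorphic_on D \<inter> ball \<zeta> \<delta>2"
    "\<And>z. z \<in> D \<inter> ball \<zeta> \<delta>2 \<Longrightarrow> (a2 z, b2 z) \<noteq> 0" "\<And>z. z \<in> D \<inter> ball \<zeta> \<delta>2 \<Longrightarrow> hproj (a2 z, b2 z) = \<psi>\<^sub>2 z"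
    "((\<lambda>z. (a2 z, b2 z)) \<longlongrightarrow> v2) (at \<zeta> within D)" "v2 \<noteq> 0" "hproj v2 = p\<^sub>2"
    by (rule boundary_coordinates[OF \<psi>(2) D(1) \<zeta> lim(2)]) (rule that)
  obtain a3 b3 v3 \<delta>3 where 3: "\<delta>3 > 0" "a3 holomorphic_on D \<inter> ball \<zeta> \<delta>3" "b3 holomorphic_on D \<inter> ball \<zeta> \<delta>3"
    "\<And>z. z \<in> D \<inter> ball \<zeta> \<delta>3 \<Longrightarrow> (a3 z, b3 z) \<noteq> 0" "\<And>z. z \<in> D \<inter> ball \<zeta> \<delta>3 \<Longrightarrow> hproj (a3 z, b3 z) = \<psi>\<^sub>3 z"
    "((\<lambda>z. (a3 z, b3 z)) \<longlongrightarrow> v3) (at \<zeta> within D)" "v3 \<noteq> 0" "hproj v3 = p\<^sub>3"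
    by (rule boundary_coordinates[OF \<psi>(3) D(1) \<zeta> lim(3)]) (rule that)
  define V1 V2 V3 where "V1 z = (a1 z, b1 z)" and "V2 z = (a2 z, b2 z)" and "V3 z = (a3 z, b3 z)" for z
  note V_defs = V1_def V2_def V3_def
  have V_lim: "(V1 \<longlongrightarrow> v1) (at \<zeta> within D)" "(V2 \<longlongrightarrow> v2) (at \<zeta> within D)" "(V3 \<longlongrightarrow> v3) (at \<zeta> within D)"
    using 1(6) 2(6) 3(6) unfolding V_defs .
  have bracket_lim: "((\<lambda>z. bracket (u z) (w z)) \<longlongrightarrow> bracket u0 w0) F"
    if "(u \<longlongrightarrow> u0) F" "(w \<longlongrightarrow> w0) F" for u w u0 w0 and F :: "complex filter"
    unfolding bracket_def using that by (intro tendsto_intros)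
  have v_ne: "bracket v1 v2 \<noteq> 0" "bracket v3 v1 \<noteq> 0" "bracket v3 v2 \<noteq> 0"
    using p 1(7,8) 2(7,8) 3(7,8) by (metis hproj_eq_iff)+
  \<comment> \<open>The factor occurring in \<open>hproj_of_cross_ratio\<close>, for the varying
    vectors; \<open>\<kappa>0\<close> is its limit at \<open>\<zeta>\<close>, finite and nonzero
    because the three boundary values are distinct.\<close>
  define \<kappa> where "\<kappa> z = bracket (V3 z) (V2 z) / bracket (V3 z) (V1 z)" for z
  define \<kappa>0 where "\<kappa>0 = bracket v3 v2 / bracket v3 v1"
  have \<kappa>_lim: "(\<kappa> \<longlongrightarrow> \<kappa>0) (at \<zeta> within D)"
    unfolding \<kappa>_def[abs_def] \<kappa>0_def using v_ne V_lim by (intro tendsto_divide bracket_lim)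
  have "\<kappa>0 \<noteq> 0" using v_ne by (simp add: \<kappa>0_def)

  have "\<forall>\<^sub>F z in at \<zeta> within D. bracket (V1 z) (V2 z) \<noteq> 0 \<and> bracket (V3 z) (V1 z) \<noteq> 0 \<and> bracket (V3 z) (V2 z) \<noteq> 0"
    using v_ne V_lim by (intro eventually_conj tendsto_imp_eventually_ne[OF bracket_lim])
  \<comment> \<open>Distinct boundary values make the brackets of the limit vectors nonzero, and
    this persists near \<open>\<zeta>\<close>.\<close>
  then obtain \<delta>4 where "\<delta>4 > 0" and \<delta>4: "\<And>z. z \<in> D \<Longrightarrow> dist z \<zeta> < \<delta>4 \<Longrightarrow>
      bracket (V1 z) (V2 z) \<noteq> 0 \<and> bracket (V3 z) (V1 z) \<noteq> 0 \<and> bracket (V3 z) (V2 z) \<noteq> 0"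
    using \<zeta> unfolding eventually_at by metis
  define \<delta> where "\<delta> = min (min \<delta>1 \<delta>2) (min \<delta>3 \<delta>4)"
  have "\<delta> > 0" using 1 2 3 \<open>\<delta>4 > 0\<close> by (simp add: \<delta>_def)
  define U where "U = D \<inter> ball \<zeta> \<delta>"
  have U: "open U" "U \<subseteq> D" "U \<subseteq> D \<inter> ball \<zeta> \<delta>1" "U \<subseteq> D \<inter> ball \<zeta> \<delta>2" "U \<subseteq> D \<inter> ball \<zeta> \<delta>3" "U \<subseteq> D \<inter> ball \<zeta> \<delta>4"
    using D by (auto simp: U_def \<delta>_def)
  have ne: "bracket (V1 z) (V2 z) \<noteq> 0" "bracket (V3 z) (V1 z) \<noteq> 0" "bracket (V3 z) (V2 z) \<noteq> 0"
    if "z \<in> U" for z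
    using \<delta>4[of z] subsetD[OF U(6) that] by (auto simp: dist_commute)
  have V0: "V1 z \<noteq> 0" "V2 z \<noteq> 0" "V3 z \<noteq> 0" if "z \<in> U" for z
    using 1(4)[OF subsetD[OF U(3) that]] 2(4)[OF subsetD[OF U(4) that]] 3(4)[OF subsetD[OF U(5) that]]
    unfolding V_defs .
  have V\<psi>: "hproj (V1 z) = \<psi>\<^sub>1 z" "hproj (V2 z) = \<psi>\<^sub>2 z" "hproj (V3 z) = \<psi>\<^sub>3 z" if "z \<in> U" for z
    using 1(5)[OF subsetD[OF U(3) that]] 2(5)[OF subsetD[OF U(4) that]] 3(5)[OF subsetD[OF U(5) that]]
    unfolding V_defs .
  have omit: "f z \<noteq> \<psi>\<^sub>1 z \<and> f z \<noteq> \<psi>\<^sub>2 z \<and> f z \<noteq> \<psi>\<^sub>3 z" if z: "z \<in> U" for z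
  proof -
    have "\<psi>\<^sub>1 z \<noteq> \<psi>\<^sub>2 z"
      using ne(1)[OF z] hproj_eq_iff[OF V0(1,2)[OF z]] V\<psi>[OF z] by simp
    then show ?thesis using share[of z] z U by (metis subsetD)
  qed
  have fne: "bracket (homog (f z)) (V1 z) \<noteq> 0" "bracket (homog (f z)) (V2 z) \<noteq> 0" "bracket (homog (f z)) (V3 z) \<noteq> 0"
    if z: "z \<in> U" for z
    using omit[OF z] hproj_eq_iff[OF homog_neq_0 V0(1)[OF z], of "f z"]
      hproj_eq_iff[OF homog_neq_0 V0(2)[OF z], of "f z"] hproj_eq_iff[OF homog_neq_0 V0(3)[OF z], of "f z"]
      V\<psi>[OF z] by (simp_all add: hproj_homog)
  \<comment> \<open>\<open>Q\<close> could be 0, infinite or 1 only where \<open>f\<close> meets the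
    first, second or third of the shared functions, which does not happen in
    \<open>U\<close>.\<close>
  define Q where "Q z = cross_ratio (homog (f z)) (V1 z) (V2 z) (V3 z)" for z
  have Q_hol: "Q holomorphic_on U"
    unfolding Q_def[abs_def] V_defs
  proof (rule holomorphic_on_cross_ratio)
    show "sphere_holomorphic_on f U" using f U(2) by (rule sphere_holomorphic_on_subset)
  qed (use U 1(2,3) 2(2,3) 3(2,3) fne(2) ne(2) in \<open>auto simp: V_defs intro: holomorphic_on_subset\<close>)
  have Q_omit: "Q z \<noteq> 0 \<and> Q z \<noteq> 1" if "z \<in> U" for z
    unfolding Q_def using cross_ratio_omits fne[OF that] ne[OF that] by blast

  \<comment> \<open>The shift by 2 makes \<open>\<rho> 0\<close> equal to 1/2, so that all factors
    are positive, as \<open>uniform_limit_rescale\<close> requires.\<close>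
  define \<rho> :: "nat \<Rightarrow> real" where "\<rho> k = 1 - inverse (real (k + 2))" for k
  have \<rho>: "0 < \<rho> k" "\<rho> k < 1" for k
    by (auto simp: \<rho>_def field_simps)
  have \<rho>_lim: "\<rho> \<longlonglongrightarrow> 1"
  proof -
    have "(\<lambda>k. 1 - inverse (real (k + 2))) \<longlonglongrightarrow> 1 - 0"
      by (intro tendsto_diff tendsto_const LIMSEQ_ignore_initial_segment[OF lim_inverse_n])
    then show ?thesis by (simp add: \<rho>_def[abs_def])
  qed
  have "\<forall>\<^sub>F n in sequentially. \<forall>z\<in>cball 0 (\<rho> k). dist (\<phi> n z) \<zeta> < min \<delta> (inverse (real (Suc k)))" for k
    using \<rho>[of k] \<open>\<delta> > 0\<close> by (intro uniform_limitD[OF conv]) (auto simp: D_def)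
  \<comment> \<open>The bound by \<open>\<delta>\<close> puts the image of the disc of radius
    \<open>\<rho> k\<close> inside \<open>U\<close>; the bound by 1/(k+1) makes the rescaled maps
    converge to \<open>\<zeta>\<close> uniformly on \<open>D\<close>.\<close>
  then obtain s where s: "strict_mono s"
    and sd: "\<And>k. \<forall>z\<in>cball 0 (\<rho> k). dist (\<phi> (s k) z) \<zeta> < min \<delta> (inverse (real (Suc k)))"
    by (rule strict_mono_eventually_diagonal[of "\<lambda>k n. \<forall>z\<in>cball 0 (\<rho> k). dist (\<phi> n z) \<zeta> < min \<delta> (inverse (real (Suc k)))"])
      (rule that)
  define \<eta> where "\<eta> k z = \<phi> (s k) (of_real (\<rho> k) * z)" for k z
  have \<rho>D: "of_real (\<rho> k) * z \<in> cball 0 (\<rho> k)" "of_real (\<rho> k) * z \<in> D" if "z \<in> D" for k z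
  proof -
    have "\<rho> k * norm z \<le> \<rho> k * 1"
      using \<rho>[of k] that by (intro mult_left_mono) (auto simp: D_def)
    then have "norm (of_real (\<rho> k) * z) \<le> \<rho> k"
      using \<rho>[of k] by (simp add: norm_mult)
    then show "of_real (\<rho> k) * z \<in> cball 0 (\<rho> k)" "of_real (\<rho> k) * z \<in> D"
      using \<rho>(2)[of k] unfolding D_def mem_ball_0 mem_cball_0 by linarith+
  qed
  have \<eta>_dist: "dist (\<eta> k z) \<zeta> < \<delta>" "dist (\<eta> k z) \<zeta> < inverse (real (Suc k))" if "z \<in> D" for k z
    using sd[of k] \<rho>D(1)[OF that] by (auto simp: \<eta>_def)
  have \<eta>_U: "\<eta> k z \<in> U" if "z \<in> D" for k z
    using \<eta>_dist(1)[OF that, of k] subsetD[OF \<phi>(2) imageI[OF \<rho>D(2)[OF that]], of "s k" k]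
    by (simp add: U_def \<eta>_def dist_commute)
  have \<eta>_hol: "\<eta> k holomorphic_on D" for k
    unfolding \<eta>_def[abs_def]
    by (rule holomorphic_on_compose_gen[OF _ \<phi>(1), unfolded o_def])
      (use \<rho>D in \<open>auto intro!: holomorphic_intros\<close>)
  have \<eta>_lim: "uniform_limit D \<eta> (\<lambda>_. \<zeta>) sequentially"
  proof (rule uniform_limitI)
    fix e :: real assume "e > 0"
    then have "\<forall>\<^sub>F k in sequentially. inverse (real (Suc k)) < e"
      using order_tendstoD(2)[OF LIMSEQ_inverse_real_of_nat] by blast
    then show "\<forall>\<^sub>F k in sequentially. \<forall>z\<in>D. dist (\<eta> k z) \<zeta> < e"
      by eventually_elim (blast intro: less_trans \<eta>_dist(2))
  qed

  obtain X Y H0 H1 r where H: "H0 holomorphic_on D" "H1 holomorphic_on D" and r: "strict_mono (r :: nat \<Rightarrow> nat)"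
    and H_nz: "\<And>z. z \<in> D \<Longrightarrow> (H0 z, H1 z) \<noteq> 0"
    and XY: "\<And>n z. z \<in> D \<Longrightarrow> Y n z \<noteq> 0 \<and> Q (\<eta> (r n) z) = X n z / Y n z"
    and X_lim: "\<And>K. compact K \<Longrightarrow> K \<subseteq> D \<Longrightarrow> uniform_limit K X H0 sequentially"
    and Y_lim: "\<And>K. compact K \<Longrightarrow> K \<subseteq> D \<Longrightarrow> uniform_limit K Y H1 sequentially"
  proof (rule omits_0_1_normal_homogeneous[OF D, of "\<lambda>n z. Q (\<eta> n z)"])
    show "(\<lambda>z. Q (\<eta> n z)) holomorphic_on D" for n
      by (rule holomorphic_on_compose_gen[OF \<eta>_hol Q_hol, unfolded o_def]) (use \<eta>_U in blast)
    show "Q (\<eta> n z) \<noteq> 0 \<and> Q (\<eta> n z) \<noteq> 1" if "z \<in> D" for n z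
      using Q_omit[OF \<eta>_U[OF that]] .
  qed (rule that)
  \<comment> \<open>The limiting cross ratio, with coordinates \<open>H0\<close> and
    \<open>H1\<close>, is inverted at the limit vectors. This makes sense also at zeros of
    \<open>H1\<close>, where the cross ratio is infinite.\<close>
  define g where "g z = hproj (comb (H0 z) v2 (\<kappa>0 * H1 z) v1)" for z
  have g_nz: "comb (H0 z) v2 (\<kappa>0 * H1 z) v1 \<noteq> 0" if "z \<in> D" for z
    using v_ne H_nz[OF that] \<open>\<kappa>0 \<noteq> 0\<close> by (intro comb_neq_0) (auto simp: zero_prod_def)
  have g: "sphere_holomorphic_on g D"
    unfolding sphere_holomorphic_on_def
  proof
    fix z assume "z \<in> D"
    then show "\<exists>U A B. open U \<and> z \<in> U \<and> A holomorphic_on U \<and> B holomorphic_on U \<and>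
        (\<forall>w\<in>U. (A w, B w) \<noteq> 0 \<and> g w = hproj (A w, B w))"
      using D g_nz
      by (intro exI[of _ D] exI[of _ "\<lambda>z. H0 z * fst v2 - \<kappa>0 * H1 z * fst v1"]
          exI[of _ "\<lambda>z. H0 z * snd v2 - \<kappa>0 * H1 z * snd v1"])
        (auto intro!: holomorphic_intros H simp: g_def comb_def)
  qed
  have f\<eta>: "f (\<eta> (r n) z) = hproj (comb (X n z) (V2 (\<eta> (r n) z)) (\<kappa> (\<eta> (r n) z) * Y n z) (V1 (\<eta> (r n) z)))"
    if z: "z \<in> D" for n z
  proof -
    note zU = \<eta>_U[OF z, of "r n"]
    show ?thesis
      using hproj_of_cross_ratio[OF fne(2)[OF zU] ne(2)[OF zU] ne(3)[OF zU] ne(1)[OF zU], of "Y n z" "X n z"]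
        XY[OF z, of n] by (simp add: hproj_homog Q_def \<kappa>_def)
  qed
  have lim_scaled: "uniform_limit K (\<lambda>n z. f (\<eta> (r n) z)) g sequentially" if K: "compact K" "K \<subseteq> D" for K
  proof -
    have "uniform_limit K \<eta> (\<lambda>_. \<zeta>) sequentially"
      using \<eta>_lim K(2) by (rule uniform_limit_on_subset)
    then have \<eta>r: "uniform_limit K (\<lambda>n. \<eta> (r n)) (\<lambda>_. \<zeta>) sequentially"
      using r by (auto intro: filterlim_compose filterlim_subseq)
    have \<eta>D: "\<eta> (r n) z \<in> D - {\<zeta>}" if "z \<in> K" for n z
      using \<eta>_U[of z "r n"] that K U(2) \<zeta> by auto
    have cont: "continuous_on K H0" "continuous_on K H1"
      using H K by (blast intro: holomorphic_on_imp_continuous_on holomorphic_on_subset)+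
    have "uniform_limit K (\<lambda>n z. hproj (comb (X n z) (V2 (\<eta> (r n) z)) (\<kappa> (\<eta> (r n) z) * Y n z) (V1 (\<eta> (r n) z))))
        (\<lambda>z. hproj (comb (H0 z) v2 (\<kappa>0 * H1 z) v1)) sequentially"
    proof (rule uniform_limit_hproj_comb[OF X_lim[OF K] Y_lim[OF K] _ _ _ K(1) cont])
      show "uniform_limit K (\<lambda>n z. V1 (\<eta> (r n) z)) (\<lambda>_. v1) sequentially"
        by (rule uniform_limit_compose_at_within[OF V_lim(1) \<eta>r \<eta>D])
      show "uniform_limit K (\<lambda>n z. V2 (\<eta> (r n) z)) (\<lambda>_. v2) sequentially"
        by (rule uniform_limit_compose_at_within[OF V_lim(2) \<eta>r \<eta>D])
      show "uniform_limit K (\<lambda>n z. \<kappa> (\<eta> (r n) z)) (\<lambda>_. \<kappa>0) sequentially"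
        by (rule uniform_limit_compose_at_within[OF \<kappa>_lim \<eta>r \<eta>D])
    qed (use g_nz K in auto)
    then show ?thesis
      by (rule uniform_limit_cong'[THEN iffD1, rotated -1]) (use K f\<eta> in \<open>auto simp: g_def\<close>)
  qed
  have "uniform_limit K (\<lambda>n z. f (\<phi> ((s \<circ> r) n) z)) g sequentially" if K: "compact K" "K \<subseteq> D" for K
  proof (rule uniform_limit_rescale[of "\<lambda>n. \<rho> (r n)"])
    show "(\<lambda>n. \<rho> (r n)) \<longlonglongrightarrow> 1"
      using LIMSEQ_subseq_LIMSEQ[OF \<rho>_lim r] by (simp add: o_def)
    show "continuous_on (ball 0 1) g"
      using sphere_holomorphic_on_continuous[OF g] by (simp add: D_def)
    show "uniform_limit K (\<lambda>n z. f (\<phi> ((s \<circ> r) n) (of_real (\<rho> (r n)) * z))) g sequentially"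
      if "compact K" "K \<subseteq> ball 0 1" for K
      using lim_scaled[of K] that by (simp add: \<eta>_def D_def)
  qed (use \<rho> K in \<open>auto simp: D_def\<close>)
  then show ?thesis
    using that[of "s \<circ> r" g] strict_mono_o[OF s r] g by blast
qed

theorem theorem1p1:
  fixes f \<psi>\<^sub>1 \<psi>\<^sub>2 \<psi>\<^sub>3 :: "complex \<Rightarrow> riemann_sphere"
  assumes "meromorphic_map_on f (ball 0 1)"
    and "meromorphic_map_on \<psi>\<^sub>1 (ball 0 1)"
    and "meromorphic_map_on \<psi>\<^sub>2 (ball 0 1)"
    and "meromorphic_map_on \<psi>\<^sub>3 (ball 0 1)"
    and "\<And>z. z \<in> sphere 0 1 \<Longrightarrow> continuous (at z within cball 0 1) \<psi>\<^sub>1"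
    and "\<And>z. z \<in> sphere 0 1 \<Longrightarrow> continuous (at z within cball 0 1) \<psi>\<^sub>2"
    and "\<And>z. z \<in> sphere 0 1 \<Longrightarrow> continuous (at z within cball 0 1) \<psi>\<^sub>3"
    and "\<And>z. z \<in> sphere 0 1 \<Longrightarrow> \<psi>\<^sub>1 z \<noteq> \<psi>\<^sub>2 z \<and> \<psi>\<^sub>1 z \<noteq> \<psi>\<^sub>3 z \<and> \<psi>\<^sub>2 z \<noteq> \<psi>\<^sub>3 z"
    and "{z \<in> ball 0 1. \<psi>\<^sub>1 z = f z} = {z \<in> ball 0 1. \<psi>\<^sub>2 z = f z}"
    and "{z \<in> ball 0 1. \<psi>\<^sub>2 z = f z} = {z \<in> ball 0 1. \<psi>\<^sub>3 z = f z}"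
  shows "normal_function f"
proof -
  let ?D = "ball (0 :: complex) 1"
  have f: "sphere_holomorphic_on f ?D"
    and \<psi>: "sphere_holomorphic_on \<psi>\<^sub>1 ?D" "sphere_holomorphic_on \<psi>\<^sub>2 ?D" "sphere_holomorphic_on \<psi>\<^sub>3 ?D"
    using assms(1-4) by (simp_all add: meromorphic_map_on_imp_sphere_holomorphic_on)
  have lim: "(\<psi> \<longlongrightarrow> \<psi> z) (at z within ?D)" if "continuous (at z within cball 0 1) \<psi>"
    for z :: complex and \<psi> :: "complex \<Rightarrow> riemann_sphere"
    using that unfolding continuous_within by (rule tendsto_within_subset) auto
  \<comment> \<open>The limit is kept as a \<open>sphere_holomorphic_on\<close> map, which may be
    constantly \<open>Infty\<close>; the two alternatives are separated only in the final
    step.\<close>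
  have converge: "\<exists>r g. strict_mono (r :: nat \<Rightarrow> nat) \<and> sphere_holomorphic_on g ?D \<and>
      (\<forall>K. compact K \<and> K \<subseteq> ?D \<longrightarrow> uniform_limit K (\<lambda>n z. f (\<phi> (r n) z)) g sequentially)"
    if \<phi>: "\<And>n. \<phi> n holomorphic_on ?D" "\<And>n. \<phi> n ` ?D \<subseteq> ?D" for \<phi> :: "nat \<Rightarrow> complex \<Rightarrow> complex"
  proof -
    have bound: "norm (\<phi> n z) \<le> 1" if "z \<in> ?D" for n z
      using \<phi>(2)[of n] that by (force intro: less_imp_le)
    obtain \<Phi> r where \<Phi>: "\<Phi> holomorphic_on ?D" and r: "strict_mono (r :: nat \<Rightarrow> nat)"
      and pt: "\<And>z. z \<in> ?D \<Longrightarrow> (\<lambda>n. \<phi> (r n) z) \<longlonglongrightarrow> \<Phi> z"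
      and unif: "\<And>K. compact K \<Longrightarrow> K \<subseteq> ?D \<Longrightarrow> uniform_limit K (\<phi> \<circ> r) \<Phi> sequentially"
    proof (rule Montel[of ?D "range \<phi>" \<phi>])
      show "\<exists>B. \<forall>h\<in>range \<phi>. \<forall>z\<in>K. norm (h z) \<le> B" if "K \<subseteq> ?D" for K
        using bound that by (intro exI[of _ 1]) blast
    qed (use \<phi> in auto)
    have \<Phi>_le: "norm (\<Phi> z) \<le> 1" if "z \<in> ?D" for z
      by (rule Lim_norm_ubound[OF _ pt[OF that]]) (use bound that in auto)
    show ?thesis
    proof (cases "\<Phi> ` ?D \<subseteq> ?D")
      case True
      have "uniform_limit K (\<lambda>n z. f (\<phi> (r n) z)) (\<lambda>z. f (\<Phi> z)) sequentially"
        if K: "compact K" "K \<subseteq> ?D" for K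
      proof (rule uniform_limit_compose_continuous_on_open)
        show "continuous_on ?D f" using f by (rule sphere_holomorphic_on_continuous)
        show "uniform_limit K (\<lambda>n. \<phi> (r n)) \<Phi> sequentially"
          using unif[OF K] by (simp add: o_def)
        show "compact (\<Phi> ` K)"
          using K \<Phi> by (intro compact_continuous_image)
            (blast intro: holomorphic_on_imp_continuous_on holomorphic_on_subset)
      qed (use K True in auto)
      moreover have "sphere_holomorphic_on (f \<circ> \<Phi>) ?D"
        using f \<Phi> True by (intro sphere_holomorphic_on_compose) auto
      ultimately show ?thesis
        using r by (intro exI[of _ r] exI[of _ "f \<circ> \<Phi>"]) (auto simp: o_def)
    next
      case False
      \<comment> \<open>A value of \<open>\<Phi>\<close> outside the open disc has norm exactly 1,
        so the norm of \<open>\<Phi>\<close> attains its maximum inside the disc and the maximum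
        modulus principle makes \<open>\<Phi>\<close> constant.\<close>
      then obtain z0 where z0: "z0 \<in> ?D" "norm (\<Phi> z0) = 1"
        using \<Phi>_le by force
      have "\<Phi> constant_on ?D"
        by (rule maximum_modulus_principle[OF \<Phi> _ _ _ order_refl z0(1)]) (use \<Phi>_le z0 in auto)
      then obtain \<zeta> where const: "\<And>z. z \<in> ?D \<Longrightarrow> \<Phi> z = \<zeta>"
        unfolding constant_on_def by blast
      then have \<zeta>: "\<zeta> \<in> sphere 0 1" using z0 by auto
      obtain t g where "strict_mono (t :: nat \<Rightarrow> nat)" "sphere_holomorphic_on g ?D"
        "\<And>K. compact K \<Longrightarrow> K \<subseteq> ?D \<Longrightarrow> uniform_limit K (\<lambda>n z. f (\<phi> (r (t n)) z)) g sequentially"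
      proof (rule convergent_subsequence_near_boundary[OF f \<psi>, of \<zeta> "\<psi>\<^sub>1 \<zeta>" "\<psi>\<^sub>2 \<zeta>" "\<psi>\<^sub>3 \<zeta>" "\<lambda>n. \<phi> (r n)"])
        show "uniform_limit K (\<lambda>n. \<phi> (r n)) (\<lambda>_. \<zeta>) sequentially" if K: "compact K" "K \<subseteq> ?D" for K
          using unif[OF K]
          by (rule uniform_limit_cong'[THEN iffD1, rotated -1]) (use K const in auto)
      qed (use \<zeta> assms(5-10) \<phi> lim in auto)
      then show ?thesis
        using strict_mono_o[OF r] by (intro exI[of _ "r \<circ> t"] exI[of _ g]) auto
    qed
  qed
  have "normal_family_on ?D {f \<circ> \<phi> | \<phi>. \<phi> \<in> disc_automorphisms}"
    unfolding normal_family_on_def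
  proof (intro allI impI)
    fix u :: "nat \<Rightarrow> complex \<Rightarrow> riemann_sphere"
    assume "range u \<subseteq> {f \<circ> \<phi> | \<phi>. \<phi> \<in> disc_automorphisms}"
    then have "\<forall>n. \<exists>\<phi>. \<phi> \<in> disc_automorphisms \<and> u n = f \<circ> \<phi>" by blast
    then obtain \<phi> where \<phi>: "\<And>n. \<phi> n \<in> disc_automorphisms" "\<And>n. u n = f \<circ> \<phi> n" by metis
    have hol: "\<phi> n holomorphic_on ?D" "\<phi> n ` ?D \<subseteq> ?D" for n
      using \<phi>(1)[of n] by (auto simp: disc_automorphisms_def bij_betw_def)
    from converge[of \<phi>, OF hol] obtain r g where "strict_mono (r :: nat \<Rightarrow> nat)" "sphere_holomorphic_on g ?D"
      "\<forall>K. compact K \<and> K \<subseteq> ?D \<longrightarrow> uniform_limit K (\<lambda>n z. f (\<phi> (r n) z)) g sequentially"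
      by (elim exE conjE)
    then show "\<exists>r g. strict_mono r \<and> (meromorphic_map_on g ?D \<or> (\<forall>z\<in>?D. g z = Infty)) \<and>
        (\<forall>K. compact K \<and> K \<subseteq> ?D \<longrightarrow> uniform_limit K (u \<circ> r) g sequentially)"
      using sphere_holomorphic_on_imp_meromorphic_map_on[of g ?D]
      by (intro exI[of _ r] exI[of _ g]) (auto simp: \<phi>(2) o_def)
  qed
  then show ?thesis
    using assms(1) by (simp add: normal_function_def)
qed

end
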